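(* Let $d>k$ be positive integers. Then $E_{k,d}$ is a polytope in $\mathbb{R}^k$ with $2^k$ vertices. Moreover, for any $J\subseteq\{1,2,\dots,k\}$, if we write $J=\{j_1,\dots,j_n\}$ where $j_1<j_2<\dots<j_n$, then $(v_1,\dots,v_k)$ is a vertex of $E_{k,d}$, where \[ v_j=\begin{cases} 0 & \text{if } j\notin J,\\[2pt] \dfrac{j_{\ell+1}-j_\ell}{j_1} & \text{if } j=j_\ell \text{ for some } \ell<n,\\[6pt] \dfrac{d-j_n}{j_1} & \text{if } j=j_n.\end{cases} \]
   Context: For an algebraic number $\alpha$ of degree $d\ge 2$ (over $\mathbb{Q}$), label its Galois conjugates (the complex roots of its minimal polynomial over $\mathbb{Q}$) as $\alpha_0,\dots,\alpha_{d-1}$ so that $|\alpha_0|\ge|\alpha_1|\ge\cdots\ge|\alpha_{d-1}|$ (the choice among conjugates of equal modulus is irrelevant). For positive integers $d>k$, $E_{k,d}$ is the set of all tuples $(c_1,\dots,c_k)\in(\mathbb{R}_{\ge 0})^k$ such that for every algebraic integer $\alpha$ of degree $d$ we have $|\alpha_0||\alpha_1|^{c_1}\cdots|\alpha_k|^{c_k}\ge 1$. A polytope in $\mathbb{R}^k$ is a bounded intersection of finitely many closed half-spaces (equivalently, the convex hull of finitely many points); its vertices are its extreme points. When $J=\emptyset$ (so $n=0$), the point $(v_1,\dots,v_k)$ is $(0,\dots,0)$. *)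

theory Defs
  imports "HOL-Analysis.Analysis" "HOL-Computational_Algebra.Polynomial"
begin

text \<open>The monic rational polynomial of least degree vanishing at an algebraic number.
  The description is only meaningful for algebraic arguments.\<close>

definition min_poly :: "complex \<Rightarrow> rat poly" where
  "min_poly \<alpha> = (THE p. lead_coeff p = 1 \<and> poly (map_poly of_rat p) \<alpha> = 0 \<and>
     (\<forall>q. q \<noteq> 0 \<and> poly (map_poly of_rat q) \<alpha> = 0 \<longrightarrow> degree p \<le> degree q))"

definition alg_degree :: "complex \<Rightarrow> nat" where
  "alg_degree \<alpha> = degree (min_poly \<alpha>)"

definition conjugates :: "complex \<Rightarrow> complex set" where
  "conjugates \<alpha> = {z. poly (map_poly of_rat (min_poly \<alpha>)) z = 0}"

text \<open>Minimal polynomials are separable, so the conjugates can be listed without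
  repetition by the indices below the degree.\<close>

definition conj_labelling :: "complex \<Rightarrow> (nat \<Rightarrow> complex) \<Rightarrow> bool" where
  "conj_labelling \<alpha> a \<longleftrightarrow>
     bij_betw a {..<alg_degree \<alpha>} (conjugates \<alpha>) \<and>
     (\<forall>i j. i \<le> j \<and> j < alg_degree \<alpha> \<longrightarrow> norm (a j) \<le> norm (a i))"

text \<open>A coordinate space is indexed by a finite linearly ordered type; \<open>coord_pos\<close> is the
  increasing bijection of that type onto \<open>{1..CARD('k)}\<close>.\<close>

definition coord_pos :: "'k::{finite,linorder} \<Rightarrow> nat" where
  "coord_pos i = card {..i}"

text \<open>For \<open>d > CARD('k)\<close> we have \<open>d \<ge> 2\<close>, so no conjugate is zero and the convention
  \<open>0 powr 0 = 0\<close> does not matter.  The product of moduli does not depend on the labelling.\<close>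

definition E_set :: "nat \<Rightarrow> (real ^ 'k::{finite,linorder}) set" where
  "E_set d = {c. (\<forall>i. 0 \<le> c $ i) \<and>
     (\<forall>\<alpha> a. algebraic_int \<alpha> \<and> alg_degree \<alpha> = d \<and> conj_labelling \<alpha> a \<longrightarrow>
        norm (a 0) * (\<Prod>i\<in>UNIV. norm (a (coord_pos i)) powr (c $ i)) \<ge> 1)}"

end

theory Submission
  imports Defs "HOL-Computational_Algebra.Computational_Algebra"
begin

text \<open>
  Taking logarithms, the condition defining \<open>E_set d\<close> says that
  \<open>x\<^sub>0 + c\<^sub>1 x\<^sub>1 + \<dots> + c\<^sub>k x\<^sub>k \<ge> 0\<close> whenever \<open>x\<^sub>0 \<ge> \<dots> \<ge> x\<^bsub>d-1\<^esub>\<close> are the logarithms of the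
  moduli of the conjugates of an algebraic integer of degree \<open>d\<close>.  The norm of such a number is
  a nonzero integer, so \<open>x\<close> lies in the cone of decreasing sequences with nonnegative sum.
  That cone is generated by the constant sequence 1 and, for \<open>0 < m < d\<close>, by the ray whose first
  \<open>m\<close> entries are \<open>d - m\<close> and whose other entries are \<open>-m\<close>.  Each of these rays is a limit of
  directions that really occur: Eisenstein's criterion at 2 makes \<open>z\<^sup>d + N z\<^bsup>d-m\<^esup> + 2\<close>
  irreducible for even \<open>N\<close>, and for large \<open>N\<close> it has \<open>m\<close> roots of modulus about \<open>N\<^bsup>1/m\<^esup>\<close> and
  \<open>d - m\<close> roots of modulus about \<open>N\<^bsup>-1/(d-m)\<^esup>\<close>.

  Evaluating the linear form on the rays gives, with \<open>S\<^sub>m = c\<^sub>m + \<dots> + c\<^sub>k\<close> and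
  \<open>T = 1 + c\<^sub>1 + \<dots> + c\<^sub>k\<close>, the inequalities \<open>d S\<^sub>m \<le> (d - m) T\<close> for \<open>m = 1, \<dots>, k\<close>; for \<open>m > k\<close> they
  are trivial.  Hence \<open>E_set d\<close> is cut out by these \<open>k\<close> inequalities together with \<open>c \<ge> 0\<close>
  (\<open>tail_polytope_subset_E_set\<close> and \<open>E_set_subset_tail_polytope\<close>).

  In the projective coordinates \<open>u\<^sub>m = S\<^sub>m / T\<close> the polytope is \<open>u\<^bsub>m+1\<^esub> \<le> u\<^sub>m \<le> 1 - m/d\<close> with
  \<open>u\<^bsub>k+1\<^esub> = 0\<close>, a combinatorial cube: each \<open>m\<close> has a lower facet \<open>c\<^sub>m = 0\<close> and an upper facet
  \<open>S\<^sub>m = (1 - m/d) T\<close>.  These two never meet because the upper bound decreases strictly in \<open>m\<close>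
  (\<open>slack_pos_if_coord_zero\<close>), and at an extreme point one of them must be active, since otherwise
  \<open>u\<^sub>m\<close>, together with the coordinates before it that are equal to it, can be moved both ways
  (\<open>extreme_point_imp_tight\<close>).  Any choice of facets has at most one common point
  (\<open>eq_if_slack_zero_on_support\<close>), and the explicit formula supplies it (\<open>vertex_of_subset\<close>), so
  that extreme points correspond to subsets of the coordinates through their supports.
\<close>

section \<open>Minimal polynomials of algebraic integers\<close>

lemma map_poly_of_int_mult:
  "map_poly (of_int :: int \<Rightarrow> 'a :: {comm_ring_1,ring_char_0}) (p * q) = map_poly of_int p * map_poly of_int q"
  by (rule poly_eqI) (simp add: coeff_map_poly coeff_mult)

lemma map_poly_of_rat_mult:
  "map_poly (of_rat :: rat \<Rightarrow> 'a :: field_char_0) (p * q) = map_poly of_rat p * map_poly of_rat q"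
  by (rule poly_eqI) (simp add: coeff_map_poly coeff_mult of_rat_sum of_rat_mult)

lemma map_poly_of_rat_add:
  "map_poly (of_rat :: rat \<Rightarrow> 'a :: field_char_0) (p + q) = map_poly of_rat p + map_poly of_rat q"
  by (rule poly_eqI) (simp add: coeff_map_poly of_rat_add)

lemma map_poly_of_rat_of_int:
  "map_poly (of_rat :: rat \<Rightarrow> 'a :: field_char_0) (map_poly of_int p) = map_poly of_int p"
  by (rule poly_eqI) (simp add: coeff_map_poly)

lemma clear_denominators:
  obtains b :: int and f where "b > 0" "smult (of_int b) p = map_poly rat_of_int f"
proof -
  have "\<exists>b>0. \<exists>f. smult (of_int b) p = map_poly rat_of_int f"
  proof (induction p)
    case 0
    show ?case by (intro exI[of _ 1] conjI exI[of _ 0]) auto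
  next
    case (pCons c p)
    then obtain b f where bf: "b > 0" "smult (of_int b) p = map_poly rat_of_int f" by blast
    obtain m n where mn: "c = of_int m / of_int n" "n > 0"
      by (metis quotient_of_denom_pos quotient_of_div surj_pair)
    have "smult (of_int (b * n)) (pCons c p) =
        pCons (of_int (b * m)) (smult (of_int n) (smult (of_int b) p))"
      using mn by (simp add: mult.commute)
    also have "\<dots> = map_poly rat_of_int (pCons (b * m) (smult n f))"
      by (simp only: bf map_poly_pCons of_int_0 map_poly_smult of_int_mult)
    finally show ?case using bf mn by (intro exI[of _ "b * n"]) auto
  qed
  thus ?thesis using that by blast
qed

text \<open>Gauss's lemma.  Contents are multiplicative and a monic polynomial has content 1, so after
  clearing denominators in both factors the content of the product is exactly the product of
  the two denominators; dividing by the contents leaves an integral factorization.\<close>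

lemma monic_factor_of_monic_int_poly:
  assumes "lead_coeff P = 1" "lead_coeff p = 1" "p dvd map_poly rat_of_int P"
  obtains f g where "P = f * g" "p = map_poly of_int f"
proof -
  obtain q where q: "map_poly rat_of_int P = p * q" using assms(3) by auto
  obtain a f0 where a: "a > 0" "smult (of_int a) p = map_poly rat_of_int f0"
    by (rule clear_denominators)
  obtain b g0 where b: "b > 0" "smult (of_int b) q = map_poly rat_of_int g0"
    by (rule clear_denominators)
  obtain f where f: "f0 = smult (content f0) f" "content f = 1" by (rule content_decompose)
  obtain g where g: "g0 = smult (content g0) g" "content g = 1" by (rule content_decompose)
  have contP: "content P = 1"
    by (metis assms(1) content_dvd_coeff is_unit_content_iff)
  have "map_poly rat_of_int (smult (a * b) P) = smult (of_int a) p * smult (of_int b) q"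
    using q by (simp add: map_poly_smult mult.commute)
  also have "\<dots> = map_poly rat_of_int (f0 * g0)"
    by (simp add: a b map_poly_of_int_mult)
  finally have eq0: "smult (a * b) P = f0 * g0"
    by (simp add: poly_eq_iff coeff_map_poly del: of_int_mult)
  have "content (smult (a * b) P) = a * b" using a b contP by simp
  moreover have "content (f0 * g0) = content f0 * content g0" by (rule content_mult)
  ultimately have c: "a * b = content f0 * content g0" using eq0 by simp
  have "f0 * g0 = smult (content f0 * content g0) (f * g)"
    by (metis f(1) g(1) mult_smult_left mult_smult_right smult_smult mult.commute)
  hence "smult (a * b) P = smult (a * b) (f * g)" unfolding c by (metis eq0 c)
  hence eq: "P = f * g" using a b by (auto simp: poly_eq_iff)
  have "lead_coeff f * lead_coeff g = 1" using eq assms(1) by (simp add: lead_coeff_mult)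
  hence lf: "lead_coeff f = 1 \<or> lead_coeff f = -1" by (metis zmult_eq_1_iff)
  have ap: "smult (of_int a) p = map_poly rat_of_int (smult (content f0) f)" using a f by simp
  have "f0 \<noteq> 0" using a assms(2) by auto
  hence "lead_coeff (smult (rat_of_int a) p) = of_int (content f0 * lead_coeff f)"
    unfolding ap by (subst lead_coeff_map_poly_nz) (use lf in \<open>auto simp: lead_coeff_smult\<close>)
  hence "rat_of_int a = of_int (content f0 * lead_coeff f)" using a(1) by (simp add: lead_coeff_smult assms)
  hence ac: "a = content f0 * lead_coeff f" by linarith
  have "normalize (content f0) = content f0" by (rule normalize_content)
  hence "content f0 \<ge> 0" by (metis abs_ge_zero normalize_int_def)
  with ac lf a have "a = content f0" by auto
  with ap have "smult (of_int a) p = smult (of_int a) (map_poly rat_of_int f)"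
    by (simp add: map_poly_smult)
  hence "p = map_poly of_int f" using a(1) by (auto simp: poly_eq_iff)
  with eq that show ?thesis by blast
qed

text \<open>The predicate inside the description that defines \<open>min_poly\<close>.\<close>

definition is_min_poly :: "complex \<Rightarrow> rat poly \<Rightarrow> bool" where
  "is_min_poly z p \<longleftrightarrow> lead_coeff p = 1 \<and> poly (map_poly of_rat p) z = 0 \<and>
     (\<forall>q. q \<noteq> 0 \<and> poly (map_poly of_rat q) z = 0 \<longrightarrow> degree p \<le> degree q)"

lemma is_min_poly_dvd:
  assumes "is_min_poly z p" "poly (map_poly of_rat q) z = 0"
  shows "p dvd q"
proof -
  have p0: "p \<noteq> 0" using assms(1) by (auto simp: is_min_poly_def)
  have "poly (map_poly of_rat (q div p * p + q mod p)) z = 0" using assms(2) by simp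
  hence "poly (map_poly of_rat (q mod p)) z = 0"
    using assms(1) unfolding map_poly_of_rat_add map_poly_of_rat_mult
    by (simp add: is_min_poly_def)
  hence "q mod p = 0"
    using assms(1) p0 degree_mod_less[OF p0, of q] by (auto simp: is_min_poly_def not_le)
  thus ?thesis by auto
qed

lemma is_min_poly_unique:
  assumes "is_min_poly z p" "is_min_poly z q"
  shows "p = q"
proof -
  have "p \<noteq> 0" "q \<noteq> 0" using assms by (auto simp: is_min_poly_def)
  hence "degree p = degree q"
    using assms by (intro antisym) (simp_all add: is_min_poly_def)
  have "p dvd p - q" using is_min_poly_dvd[OF assms(1)] assms(2)
    by (simp add: is_min_poly_def)
  moreover have "p = q \<or> degree (p - q) < degree p"
  proof (rule disjCI)
    assume "\<not> degree (p - q) < degree p"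
    moreover have "degree (p - q) \<le> degree p"
      using \<open>degree p = degree q\<close> by (metis degree_diff_le_max max.idem)
    moreover have "coeff (p - q) (degree p) = 0"
      using assms \<open>degree p = degree q\<close> by (simp add: is_min_poly_def)
    ultimately show "p = q" by (metis eq_iff_diff_eq_0 leading_coeff_0_iff linorder_not_less order_antisym_conv)
  qed
  ultimately show ?thesis using dvd_imp_degree_le[of p "p - q"] by fastforce
qed

lemma min_poly_eqI: "is_min_poly z p \<Longrightarrow> min_poly z = p"
  unfolding min_poly_def using is_min_poly_unique[of z]
  by (intro the_equality) (auto simp: is_min_poly_def)

lemma is_min_poly_min_poly:
  assumes "q \<noteq> 0" "poly (map_poly of_rat q) z = 0"
  shows "is_min_poly z (min_poly z)"
proof -
  define S where "S = {q. q \<noteq> 0 \<and> poly (map_poly of_rat q) z = 0}"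
  obtain r where r: "r \<in> S" "\<And>q. q \<in> S \<Longrightarrow> degree r \<le> degree q"
    using assms ex_has_least_nat[of "\<lambda>q. q \<in> S" q degree] by (auto simp: S_def)
  define p where "p = smult (inverse (lead_coeff r)) r"
  have "map_poly of_rat p = smult (of_rat (inverse (lead_coeff r))) (map_poly of_rat r :: complex poly)"
    by (simp add: p_def map_poly_smult of_rat_mult)
  hence "is_min_poly z p"
    using r by (auto simp: is_min_poly_def p_def S_def lead_coeff_smult)
  thus ?thesis using min_poly_eqI by metis
qed

text \<open>The minimal polynomial divides every rational polynomial vanishing at the number, in
  particular the monic integral one, so Gauss's lemma applies.\<close>

lemma min_poly_integral:
  assumes "lead_coeff P = 1" "poly (map_poly of_int P) z = 0"
  obtains f g where "P = f * g" "min_poly z = map_poly of_int f" "lead_coeff f = 1"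
    "is_min_poly z (min_poly z)"
proof -
  have P0: "map_poly rat_of_int P \<noteq> 0" using assms(1)
    by (metis lead_coeff_map_poly_nz leading_coeff_0_iff of_int_1 of_int_0 zero_neq_one)
  have m: "is_min_poly z (min_poly z)"
    by (rule is_min_poly_min_poly[OF P0]) (simp add: map_poly_of_rat_of_int assms)
  moreover have "min_poly z dvd map_poly rat_of_int P"
    by (rule is_min_poly_dvd[OF m]) (simp add: map_poly_of_rat_of_int assms)
  ultimately obtain f g where fg: "P = f * g" "min_poly z = map_poly of_int f"
    using monic_factor_of_monic_int_poly[OF assms(1)] by (metis is_min_poly_def)
  moreover have "lead_coeff f = 1"
    using m fg(2) by (auto simp: is_min_poly_def coeff_map_poly degree_map_poly)
  ultimately show ?thesis using that m by blast
qed

lemma monic_poly_eq_prod_roots: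
  fixes p :: "'a :: idom poly"
  assumes "lead_coeff p = 1" "inj_on a {..<degree p}" "\<And>i. i < degree p \<Longrightarrow> poly p (a i) = 0"
  shows "p = (\<Prod>i<degree p. [:- a i, 1:])"
proof (rule poly_eqI_degree_lead_coeff[where n = "degree p" and A = "a ` {..<degree p}"])
  have "degree (\<Prod>i<degree p. [:- a i, 1:]) = degree p"
    by (subst degree_prod_eq_sum_degree) auto
  moreover have "lead_coeff (\<Prod>i<degree p. [:- a i, 1:]) = 1"
    by (simp add: lead_coeff_prod)
  ultimately show "coeff p (degree p) = coeff (\<Prod>i<degree p. [:- a i, 1:]) (degree p)"
    "degree (\<Prod>i<degree p. [:- a i, 1:]) \<le> degree p"
    using assms(1) by auto
qed (use assms in \<open>auto simp: card_image poly_prod\<close>)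

text \<open>A labelling lists as many distinct roots of the minimal polynomial as its degree, so the
  polynomial is the product of the linear factors and its constant coefficient is the norm up to
  sign.  Separability of minimal polynomials is thus part of the assumption on \<open>a\<close>.\<close>

lemma conj_labelling_prod:
  assumes "min_poly \<alpha> = map_poly of_int f" "lead_coeff f = 1" "conj_labelling \<alpha> a"
  shows "(\<Prod>i<alg_degree \<alpha>. norm (a i)) = \<bar>of_int (coeff f 0)\<bar>"
proof -
  define p where "p = (map_poly of_int f :: complex poly)"
  have d: "alg_degree \<alpha> = degree p"
    by (simp add: alg_degree_def assms p_def degree_map_poly)
  have c: "conjugates \<alpha> = {z. poly p z = 0}"
    by (simp add: conjugates_def assms p_def map_poly_of_rat_of_int)
  have "p = (\<Prod>i<degree p. [:- a i, 1:])"
  proof (rule monic_poly_eq_prod_roots)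
    show "lead_coeff p = 1" using assms(2) by (simp add: p_def degree_map_poly coeff_map_poly)
    show "inj_on a {..<degree p}" "\<And>i. i < degree p \<Longrightarrow> poly p (a i) = 0"
      using assms(3) unfolding conj_labelling_def d c by (auto simp: bij_betw_def)
  qed
  hence "poly p 0 = (\<Prod>i<degree p. - a i)" by (metis (no_types, lifting) poly_prod poly_pCons poly_0 mult_zero_left add.right_neutral prod.cong mult_zero_right)
  hence "norm (poly p 0) = (\<Prod>i<alg_degree \<alpha>. norm (a i))" by (simp add: d prod_norm[symmetric])
  moreover have "norm (poly p 0) = \<bar>of_int (coeff f 0)\<bar>"
    by (simp add: p_def poly_0_coeff_0 coeff_map_poly)
  ultimately show ?thesis by simp
qed

text \<open>The norm is a nonzero integer: a vanishing constant coefficient would allow splitting off the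
  factor \<open>X\<close>, and either \<open>X\<close> itself or the cofactor would be a polynomial of smaller degree
  vanishing at \<open>\<alpha>\<close>.  The bound on the degree excludes \<open>\<alpha> = 0\<close>.\<close>

lemma one_le_prod_norm_conjugates:
  assumes "algebraic_int \<alpha>" "alg_degree \<alpha> \<ge> 2" "conj_labelling \<alpha> a"
  shows "(\<Prod>i<alg_degree \<alpha>. norm (a i)) \<ge> 1"
proof -
  obtain P where P: "poly (map_poly of_int P) \<alpha> = 0" "lead_coeff P = 1"
    using assms(1) by (auto simp: algebraic_int_altdef_ipoly)
  obtain f where f: "min_poly \<alpha> = map_poly of_int f" "lead_coeff f = 1"
    "is_min_poly \<alpha> (min_poly \<alpha>)"
    using min_poly_integral[OF P(2,1)] by metis
  have d: "alg_degree \<alpha> = degree f"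
    by (simp add: alg_degree_def f(1) degree_map_poly)
  have "coeff f 0 \<noteq> 0"
  proof
    assume "coeff f 0 = 0"
    hence "[:0, 1:] dvd f" by (metis dvd_iff_poly_eq_0 add.inverse_neutral poly_0_coeff_0)
    then obtain g where g: "f = [:0, 1:] * g" by auto
    with f(2) have g0: "g \<noteq> 0" by auto
    have root: "poly (map_poly of_int f) \<alpha> = 0"
      using f(1,3) by (simp add: is_min_poly_def map_poly_of_rat_of_int)
    have X: "map_poly of_int [:0, 1:] = [:0, 1 :: complex:]" by (simp add: map_poly_pCons)
    have "\<alpha> * poly (map_poly of_int g) \<alpha> = 0"
      using root unfolding g map_poly_of_int_mult X by simp
    hence "\<exists>h::int poly. h \<noteq> 0 \<and> degree h < degree f \<and> poly (map_poly of_int h) \<alpha> = 0"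
    proof (cases "\<alpha> = 0")
      case True
      thus ?thesis using assms(2) d by (intro exI[of _ "[:0, 1:]"]) (auto simp: map_poly_pCons)
    next
      case False
      with \<open>\<alpha> * _ = 0\<close> g0 show ?thesis by (intro exI[of _ g]) (auto simp: g degree_mult_eq)
    qed
    then obtain h :: "int poly" where h: "h \<noteq> 0" "degree h < degree f" "poly (map_poly of_int h) \<alpha> = 0"
      by blast
    have "map_poly rat_of_int h \<noteq> 0" using h(1) by (simp add: map_poly_eq_0_iff)
    thus False using f(3) h
      by (auto simp: is_min_poly_def f(1) degree_map_poly map_poly_of_rat_of_int
               dest!: spec[of _ "map_poly rat_of_int h"])
  qed
  hence "\<bar>coeff f 0\<bar> \<ge> 1" by linarith
  thus ?thesis unfolding conj_labelling_prod[OF f(1,2) assms(3)] by (metis of_int_1_le_iff of_int_abs)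
qed

section \<open>Eisenstein polynomials\<close>

text \<open>At the first coefficient of \<open>f\<close> that \<open>p\<close> does not divide, the corresponding coefficient of
  \<open>f * g\<close> is not divisible by \<open>p\<close> either.  By hypothesis that can only be the leading one, so \<open>f\<close>
  accounts for the whole degree.\<close>

lemma eisenstein_aux:
  fixes p :: int
  assumes "prime p" "\<not> p dvd lead_coeff (f * g)" "\<And>i. i < degree (f * g) \<Longrightarrow> p dvd coeff (f * g) i"
    and "\<not> p dvd coeff g 0"
  shows "degree g = 0"
proof -
  have nz: "f \<noteq> 0" "g \<noteq> 0" using assms(2) by auto
  have ex: "\<not> p dvd coeff f (degree f)" using assms(2) by (auto simp: lead_coeff_mult)
  define i where "i = (LEAST i. \<not> p dvd coeff f i)"
  have i: "\<not> p dvd coeff f i" unfolding i_def by (rule LeastI, rule ex)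
  have less: "p dvd coeff f j" if "j < i" for j using not_less_Least that unfolding i_def by blast
  have "i \<le> degree f" unfolding i_def by (rule Least_le, rule ex)
  have "coeff (f * g) i = (\<Sum>j<i. coeff f j * coeff g (i - j)) + coeff f i * coeff g 0"
    by (simp add: coeff_mult lessThan_Suc_atMost[symmetric])
  moreover have "p dvd (\<Sum>j<i. coeff f j * coeff g (i - j))"
    by (intro dvd_sum) (auto simp: less)
  ultimately have "\<not> p dvd coeff (f * g) i"
    using i assms(4) prime_dvd_mult_iff[OF assms(1)] by (simp add: dvd_add_right_iff)
  hence "degree (f * g) \<le> i" using assms(3)[of i] by linarith
  with \<open>i \<le> degree f\<close> nz show ?thesis by (simp add: degree_mult_eq)
qed

lemma eisenstein_criterion:
  fixes p :: int
  assumes "prime p" "\<not> p dvd lead_coeff (f * g)" "\<And>i. i < degree (f * g) \<Longrightarrow> p dvd coeff (f * g) i"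
    and "\<not> p\<^sup>2 dvd coeff (f * g) 0"
  shows "degree f = 0 \<or> degree g = 0"
proof (cases "p dvd coeff g 0")
  case True
  hence "\<not> p dvd coeff f 0"
    using assms(4) by (auto simp: power2_eq_square coeff_mult_0 mult_dvd_mono)
  thus ?thesis using eisenstein_aux[of p g f] assms by (simp add: mult.commute)
qed (use eisenstein_aux[of p f g] assms in auto)

lemma min_poly_eisenstein:
  fixes p :: int
  assumes "prime p" "lead_coeff P = 1" "\<And>i. i < degree P \<Longrightarrow> p dvd coeff P i"
    and "\<not> p\<^sup>2 dvd coeff P 0" and z: "poly (map_poly of_int P) z = 0"
  shows "is_min_poly z (map_poly of_int P)"
proof -
  obtain f g where fg: "P = f * g" "min_poly z = map_poly of_int f" "lead_coeff f = 1"
    "is_min_poly z (min_poly z)"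
    using min_poly_integral[OF assms(2) z] by metis
  have "degree f \<noteq> 0"
  proof
    assume "degree f = 0"
    with fg(3) have "f = 1" by (metis degree_eq_zeroE lead_coeff_pCons(2) one_pCons)
    thus False using fg(2,4) by (simp add: is_min_poly_def)
  qed
  moreover have "\<not> p dvd lead_coeff P" using assms(1,2) by (auto dest: not_prime_unit)
  ultimately have "degree g = 0"
    using eisenstein_criterion[of p f g] assms fg(1) by auto
  moreover have "lead_coeff g = 1" using fg(1,3) assms(2) by (simp add: lead_coeff_mult)
  ultimately have "g = 1" by (metis degree_eq_zeroE lead_coeff_pCons(2) one_pCons)
  thus ?thesis using fg by simp
qed

text \<open>Separability: if \<open>p\<close> is the minimal polynomial of each of its roots, then the derivative, a
  nonzero rational polynomial of smaller degree, vanishes at none of them.\<close>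

lemma card_conjugates:
  assumes irr: "\<And>z. poly (map_poly of_rat p) z = 0 \<Longrightarrow> is_min_poly z p"
    and "poly (map_poly of_rat p) \<alpha> = 0" "degree p > 0"
  shows "alg_degree \<alpha> = degree p" "finite (conjugates \<alpha>)" "card (conjugates \<alpha>) = degree p"
proof -
  define q where "q = (map_poly of_rat p :: complex poly)"
  have m: "min_poly \<alpha> = p" using assms min_poly_eqI by blast
  thus d: "alg_degree \<alpha> = degree p" by (simp add: alg_degree_def)
  have c: "conjugates \<alpha> = {z. poly q z = 0}" by (simp add: conjugates_def m q_def)
  have dq: "degree q = degree p" by (simp add: q_def degree_map_poly)
  have lq: "lead_coeff q = 1" using irr[OF assms(2)]
    by (simp add: is_min_poly_def q_def degree_map_poly coeff_map_poly)
  hence "q \<noteq> 0" by auto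
  thus "finite (conjugates \<alpha>)" unfolding c by (rule poly_roots_finite)
  have pd: "pderiv q = map_poly of_rat (pderiv p)"
    by (rule poly_eqI) (simp add: q_def coeff_pderiv coeff_map_poly of_rat_mult of_rat_add)
  have "pderiv p \<noteq> 0" using assms(3) by (simp add: pderiv_eq_0_iff)
  have "poly (pderiv q) z \<noteq> 0" if "poly q z = 0" for z
  proof
    assume "poly (pderiv q) z = 0"
    with \<open>pderiv p \<noteq> 0\<close> irr[of z] that have "degree p \<le> degree (pderiv p)"
      unfolding pd by (auto simp: is_min_poly_def q_def)
    thus False using assms(3) by (simp add: degree_pderiv)
  qed
  hence "rsquarefree q" by (auto simp: rsquarefree_roots)
  from complex_poly_decompose_rsquarefree[OF this]
  have "(\<Prod>z | poly q z = 0. [:-z, 1:]) = q" by (simp add: lq)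
  moreover have "degree (\<Prod>z | poly q z = 0. [:-z, 1:]) = card {z. poly q z = 0}"
    by (subst degree_prod_eq_sum_degree) auto
  ultimately show "card (conjugates \<alpha>) = degree p" by (simp add: c dq)
qed

lemma conj_labelling_exists:
  assumes "finite (conjugates \<alpha>)" "card (conjugates \<alpha>) = alg_degree \<alpha>"
  obtains a where "conj_labelling \<alpha> a"
proof -
  obtain xs where xs: "set xs = conjugates \<alpha>" "distinct xs"
    using finite_distinct_list[OF assms(1)] by blast
  define ys where "ys = sort_key (\<lambda>z. - norm z) xs"
  have ys: "set ys = conjugates \<alpha>" "distinct ys" by (simp_all add: ys_def xs)
  have len: "length ys = alg_degree \<alpha>" using ys assms(2) distinct_card by fastforce
  have "sorted (map (\<lambda>z. - norm z) ys)" by (simp add: ys_def)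
  hence "norm (ys ! j) \<le> norm (ys ! i)" if "i \<le> j" "j < length ys" for i j
    using sorted_nth_mono[of "map (\<lambda>z. - norm z) ys" i j] that by simp
  moreover have "bij_betw ((!) ys) {..<length ys} (conjugates \<alpha>)"
    using ys by (intro bij_betw_nth) auto
  ultimately have "conj_labelling \<alpha> ((!) ys)" by (auto simp: conj_labelling_def len)
  thus ?thesis using that by blast
qed

section \<open>Conjugates close to an extreme ray\<close>

definition trinomial :: "int \<Rightarrow> nat \<Rightarrow> nat \<Rightarrow> int poly" where
  "trinomial N m d = monom 1 d + monom N (d - m) + [:2:]"

lemma coeff_trinomial:
  assumes "0 < m" "m < d"
  shows "coeff (trinomial N m d) i = (if i = d then 1 else if i = d - m then N else if i = 0 then 2 else 0)"
  using assms by (auto simp: trinomial_def coeff_pCons split: nat.splits)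

lemma degree_trinomial:
  assumes "0 < m" "m < d"
  shows "degree (trinomial N m d) = d"
  using assms by (intro antisym degree_le le_degree) (auto simp: coeff_trinomial)

lemma poly_trinomial:
  "poly (map_poly of_int (trinomial N m d)) z = z ^ d + of_int N * z ^ (d - m) + (2 :: complex)"
proof -
  have "map_poly of_int (trinomial N m d) = monom 1 d + monom (of_int N) (d - m) + [:2 :: complex:]"
    by (rule poly_eqI) (auto simp: trinomial_def coeff_map_poly coeff_pCons split: nat.splits)
  thus ?thesis by (simp add: poly_monom)
qed

lemma min_poly_trinomial:
  assumes "0 < m" "m < d" "even N" "poly (map_poly of_int (trinomial N m d)) z = 0"
  shows "is_min_poly z (map_poly of_int (trinomial N m d))"
proof (rule min_poly_eisenstein[where p = 2])
  show "\<not> 2\<^sup>2 dvd coeff (trinomial N m d) 0" using assms by (auto simp: coeff_trinomial)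
qed (use assms in \<open>auto simp: degree_trinomial coeff_trinomial\<close>)

text \<open>A root satisfies \<open>z\<^bsup>d-m\<^esup> (z\<^sup>m + N) = -2\<close>.  So if \<open>\<bar>z\<bar> > 1\<close> then \<open>z\<^sup>m\<close> is within 2 of \<open>-N\<close>, while
  if \<open>\<bar>z\<bar> \<le> 1\<close> then the second factor has modulus between \<open>N - 1\<close> and \<open>N + 1\<close>, which determines
  \<open>\<bar>z\<bar>\<^bsup>d-m\<^esup>\<close>.  The next two lemmas put these estimates in logarithmic form.\<close>

lemma trinomial_root_factored:
  fixes z :: complex and m d :: nat and N :: int
  assumes "m \<le> d" "z ^ d + of_int N * z ^ (d - m) + 2 = 0"
  shows "norm z ^ (d - m) * norm (z ^ m + of_int N) = 2" 
proof -
  have "z ^ (d - m) * (z ^ m + of_int N) = -2"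
    using assms by (simp add: algebra_simps power_add[symmetric] add_eq_0_iff)
  from arg_cong[OF this, of norm] show ?thesis by (simp add: norm_mult norm_power)
qed

lemma trinomial_root_large:
  fixes z :: complex and m d :: nat and N :: int
  assumes "0 < m" "m \<le> d" "N \<ge> 4" "z ^ d + of_int N * z ^ (d - m) + 2 = 0" "norm z > 1"
  shows "ln N - 1 \<le> m * ln (norm z)" "m * ln (norm z) \<le> ln N + 1"
proof -
  have "norm z ^ (d - m) \<ge> 1" using assms(5) by simp
  hence "norm (z ^ m + of_int N) \<le> 2"
    using trinomial_root_factored[OF assms(2,4)]
    by (metis mult.commute mult_le_cancel_left1 norm_ge_zero order_trans less_le_not_le mult_left_mono mult.right_neutral)
  moreover have "norm (of_int N :: complex) = N" using assms(3) by simp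
  ultimately have b: "N - 2 \<le> norm z ^ m" "norm z ^ m \<le> N + 2"
    using norm_triangle_ineq2[of "of_int N :: complex" "- (z ^ m)"] norm_triangle_ineq2[of "z ^ m" "- (of_int N :: complex)"]
    by (simp_all add: norm_power algebra_simps)
  have "ln (N / 2) \<le> ln (norm z ^ m)" "ln (norm z ^ m) \<le> ln (2 * N)"
    using b assms(3,5) by (auto intro!: ln_mono)
  moreover have "ln (N / 2) = ln N - ln 2" "ln (2 * N) = ln 2 + ln N"
    using assms(3) by (simp_all add: ln_div ln_mult)
  moreover have "ln 2 \<le> (1::real)" using ln_le_minus_one[of 2] by simp
  moreover have "ln (norm z ^ m) = m * ln (norm z)" using assms(5) by (simp add: ln_realpow)
  ultimately show "ln N - 1 \<le> m * ln (norm z)" "m * ln (norm z) \<le> ln N + 1" by linarith+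
qed

lemma trinomial_root_small:
  fixes z :: complex and m d :: nat and N :: int
  assumes "0 < m" "m < d" "N \<ge> 4" "z ^ d + of_int N * z ^ (d - m) + 2 = 0" "norm z \<le> 1"
  shows "- ln N \<le> real (d - m) * ln (norm z)" "real (d - m) * ln (norm z) \<le> 2 - ln N"
proof -
  define w where "w = norm (z ^ m + of_int N)"
  have eq: "norm z ^ (d - m) * w = 2"
    using trinomial_root_factored[of m d z N] assms by (simp add: w_def)
  have z0: "norm z > 0"
  proof (rule ccontr)
    assume "\<not> norm z > 0"
    hence "z = 0" by simp
    thus False using assms by (simp add: power_0_left)
  qed
  have "norm (of_int N :: complex) = N" using assms(3) by simp
  moreover have "norm (z ^ m) \<le> 1" using assms(5) by (simp add: norm_power power_le_one)
  ultimately have w: "N - 1 \<le> w" "w \<le> N + 1"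
    using norm_triangle_ineq2[of "of_int N :: complex" "- (z ^ m)"] norm_triangle_ineq[of "z ^ m" "of_int N :: complex"]
    by (simp_all add: w_def algebra_simps)
  have "ln (norm z ^ (d - m) * w) = real (d - m) * ln (norm z) + ln w"
    using w z0 assms(3) by (subst ln_mult) (auto simp: ln_realpow)
  hence "real (d - m) * ln (norm z) = ln 2 - ln w" using eq by simp
  moreover have "ln (N / 2) \<le> ln w" "ln w \<le> ln (2 * N)"
    using w assms(3) by (auto intro!: ln_mono)
  moreover have "ln (N / 2) = ln N - ln 2" "ln (2 * N) = ln 2 + ln N"
    using assms(3) by (simp_all add: ln_div ln_mult)
  moreover have "ln 2 \<le> (1::real)" using ln_le_minus_one[of 2] by simp
  ultimately show "- ln N \<le> real (d - m) * ln (norm z)" "real (d - m) * ln (norm z) \<le> 2 - ln N" by linarith+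
qed

text \<open>It remains to see that at most \<open>m\<close> roots lie outside the unit disc.  This is read off from
  the product of all the moduli, which is 2: \<open>m + 1\<close> large roots, each of modulus about
  \<open>N\<^bsup>1/m\<^esup>\<close>, could not be compensated by the remaining \<open>d - m - 1\<close> ones, none of which is much
  smaller than \<open>N\<^bsup>-1/(d-m)\<^esup>\<close>.  The conclusion consists of
  upper bounds because the moduli will enter with nonnegative exponents.\<close>

lemma trinomial_conjugates:
  fixes m d :: nat and N :: int
  assumes md: "0 < m" "m < d" and N: "even N" "N \<ge> 4" "ln N > 3 * m"
  obtains \<alpha> a where "algebraic_int \<alpha>" "alg_degree \<alpha> = d" "conj_labelling \<alpha> a"
    "\<And>i. i < d \<Longrightarrow> a i \<noteq> 0"
    "\<And>i. i < m \<Longrightarrow> ln (norm (a i)) \<le> (ln N + 1) / m"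
    "\<And>i. m \<le> i \<Longrightarrow> i < d \<Longrightarrow> ln (norm (a i)) \<le> (2 - ln N) / real (d - m)"
proof -
  define P where "P = trinomial N m d"
  have dP: "degree P = d" and lP: "lead_coeff P = 1"
    using md by (simp_all add: P_def degree_trinomial coeff_trinomial)
  define p where "p = map_poly rat_of_int P"
  have dp: "degree p = d" by (simp add: p_def degree_map_poly dP)
  have pP: "map_poly of_rat p = (map_poly of_int P :: complex poly)"
    by (simp add: p_def map_poly_of_rat_of_int)
  have "degree (map_poly of_int P :: complex poly) > 0" using dP md by (simp add: degree_map_poly)
  hence "\<not> constant (poly (map_poly of_int P :: complex poly))" by (simp add: constant_degree)
  then obtain \<alpha> where \<alpha>: "poly (map_poly of_int P) \<alpha> = (0::complex)"
    using fundamental_theorem_of_algebra by blast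
  have irr: "is_min_poly z p" if "poly (map_poly of_rat p) z = 0" for z
    using min_poly_trinomial[OF md N(1)] that unfolding pP by (simp add: P_def p_def)
  have conj: "alg_degree \<alpha> = degree p" "finite (conjugates \<alpha>)" "card (conjugates \<alpha>) = degree p"
    using card_conjugates[of p \<alpha>] irr \<alpha> md by (simp_all add: pP dp)
  obtain a where a: "conj_labelling \<alpha> a" using conj_labelling_exists conj by metis
  have min: "min_poly \<alpha> = map_poly of_int P" using min_poly_eqI[OF irr] \<alpha> pP p_def by auto
  have root: "(a i) ^ d + of_int N * (a i) ^ (d - m) + 2 = 0" if "i < d" for i
  proof -
    have "a i \<in> conjugates \<alpha>" using a that conj(1) dp by (auto simp: conj_labelling_def bij_betw_def)
    thus ?thesis by (simp add: conjugates_def min map_poly_of_rat_of_int P_def poly_trinomial)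
  qed
  have mono: "norm (a j) \<le> norm (a i)" if "i \<le> j" "j < d" for i j
    using a that conj(1) dp by (simp add: conj_labelling_def)
  have nz: "a i \<noteq> 0" if "i < d" for i using root[OF that] md by (auto simp: power_0_left)
  define y where "y = (\<lambda>i. ln (norm (a i)))"
  have "(\<Prod>i<d. norm (a i)) = \<bar>of_int (coeff P 0)\<bar>"
    using conj_labelling_prod[OF min lP a] conj(1) dp by simp
  hence "(\<Prod>i<d. norm (a i)) = 2" using md by (simp add: P_def coeff_trinomial)
  hence "ln 2 = ln (\<Prod>i<d. norm (a i))" by simp
  also have "\<dots> = (\<Sum>i<d. y i)" unfolding y_def using nz by (intro ln_prod) auto
  finally have sum: "(\<Sum>i<d. y i) = ln 2" ..
  have large: "ln N - 1 \<le> m * y i" "m * y i \<le> ln N + 1" if "i < d" "norm (a i) > 1" for i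
    using trinomial_root_large[OF md(1) _ N(2) root[OF that(1)] that(2)] md by (simp_all add: y_def)
  have small: "- ln N \<le> real (d - m) * y i" "real (d - m) * y i \<le> 2 - ln N" if "i < d" "norm (a i) \<le> 1" for i
    using trinomial_root_small[OF md N(2) root[OF that(1)] that(2)] md by (simp_all add: y_def)
  have lower: "- ln N / real (d - m) \<le> y i" if "i < d" for i
  proof (cases "norm (a i) > 1")
    case True
    hence "0 \<le> y i" by (simp add: y_def)
    moreover have "- ln N / real (d - m) \<le> 0" using N md by (simp add: field_simps)
    ultimately show ?thesis by (rule order_trans[rotated])
  next
    case False
    with small(1)[OF that] show ?thesis using md by (simp add: field_simps)
  qed
  have am: "norm (a m) \<le> 1"
  proof (rule ccontr)
    assume *: "\<not> norm (a m) \<le> 1"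
    have "(ln N - 1) / m \<le> y i" if "i \<in> {..m}" for i
    proof -
      have "norm (a i) > 1" using mono[of i m] * that md by auto
      thus ?thesis using large(1)[of i] that md by (simp add: field_simps)
    qed
    \<comment> \<open>The large roots contribute about \<open>(m + 1)/m\<close> times \<open>ln N\<close> and the others at least \<open>- ln N\<close>.\<close>
    hence "real (card {..m}) * ((ln N - 1) / m) \<le> (\<Sum>i\<le>m. y i)"
      by (intro sum_bounded_below)
    moreover have "real (card {..m}) * ((ln N - 1) / m) = ln N - 1 + (ln N - 1) / m"
      using md by (simp add: field_simps)
    ultimately have "ln N - 1 + (ln N - 1) / m \<le> (\<Sum>i\<le>m. y i)" by simp
    moreover have "real (card {m<..<d}) * (- ln N / real (d - m)) \<le> (\<Sum>i\<in>{m<..<d}. y i)"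
      using lower by (intro sum_bounded_below) auto
    moreover have "- ln N \<le> real (card {m<..<d}) * (- ln N / real (d - m))"
      using md N by (simp add: field_simps)
    ultimately have "ln N - 1 + (ln N - 1) / m \<le> (\<Sum>i\<le>m. y i)" "- ln N \<le> (\<Sum>i\<in>{m<..<d}. y i)"
      by (blast, blast intro: order_trans)
    moreover have "(\<Sum>i<d. y i) = (\<Sum>i\<le>m. y i) + (\<Sum>i\<in>{m<..<d}. y i)"
      using md by (subst sum.union_disjoint[symmetric]) (auto intro!: sum.cong)
    moreover have "(ln N - 1) / m > 2"
      using md N(3) by (simp add: field_simps)
    moreover have "ln 2 < (1::real)" using ln_less_self[of 2] ln_2_less_1 by simp
    ultimately show False using sum by linarith
  qed
  have "y i \<le> (ln N + 1) / m" if "i < m" for i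
  proof (cases "norm (a i) > 1")
    case True
    with large(2)[of i] show ?thesis using that md by (simp add: field_simps)
  next
    case False
    hence "y i \<le> 0" using nz[of i] that md by (simp add: y_def)
    moreover have "(ln N + 1) / m \<ge> 0" using N by simp
    ultimately show ?thesis by linarith
  qed
  moreover have "y i \<le> (2 - ln N) / real (d - m)" if "m \<le> i" "i < d" for i
    using small(2)[of i] mono[OF that] am that md by (simp add: field_simps)
  moreover have "algebraic_int \<alpha>" using \<alpha> lP by (auto simp: algebraic_int_altdef_ipoly)
  ultimately show ?thesis using that[of \<alpha> a] a conj(1) dp nz by (simp add: y_def)
qed

section \<open>The inequalities that describe the exponents\<close>

lemma coord_pos_less: "i < j \<Longrightarrow> coord_pos i < coord_pos (j :: 'k :: {finite,linorder})"
  unfolding coord_pos_def by (rule psubset_card_mono) auto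

lemma coord_pos_le_iff [simp]:
  "coord_pos i \<le> coord_pos j \<longleftrightarrow> i \<le> (j :: 'k :: {finite,linorder})"
  using coord_pos_less[of i j] coord_pos_less[of j i] by (cases i j rule: linorder_cases) auto

lemma coord_pos_less_iff [simp]:
  "coord_pos i < coord_pos j \<longleftrightarrow> i < (j :: 'k :: {finite,linorder})"
  by (simp add: not_le[symmetric])

lemma inj_coord_pos: "inj (coord_pos :: 'k :: {finite,linorder} \<Rightarrow> nat)"
  by (rule injI) (metis coord_pos_le_iff order_antisym order_refl)

lemma coord_pos_pos: "0 < coord_pos (i :: 'k :: {finite,linorder})"
  unfolding coord_pos_def by (auto simp: card_gt_0_iff)

lemma coord_pos_le_card: "coord_pos (i :: 'k :: {finite,linorder}) \<le> CARD('k)"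
  unfolding coord_pos_def by (rule card_mono) auto

lemma range_coord_pos: "range (coord_pos :: 'k :: {finite,linorder} \<Rightarrow> nat) = {1..CARD('k)}"
proof (rule card_subset_eq)
  show "range (coord_pos :: 'k \<Rightarrow> nat) \<subseteq> {1..CARD('k)}"
    using coord_pos_pos[where ?'k = 'k] coord_pos_le_card[where ?'k = 'k] by (auto simp: Suc_le_eq)
qed (simp_all add: card_image inj_coord_pos)

definition tail_sum :: "real ^ 'k :: {finite,linorder} \<Rightarrow> 'k \<Rightarrow> real" where
  "tail_sum c i = (\<Sum>j\<in>{i..}. c $ j)"

definition total_weight :: "real ^ 'k :: {finite,linorder} \<Rightarrow> real" where
  "total_weight c = 1 + (\<Sum>j\<in>UNIV. c $ j)"

text \<open>The value of the linear form \<open>x\<^sub>0 + \<Sum>c\<^sub>i x\<^sub>i\<close> at the ray whose first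
  \<open>m = coord_pos i\<close> entries are \<open>d - m\<close> and whose other entries are \<open>-m\<close>: it is
  \<open>(d - m) (T - S) - m S\<close> for the total weight \<open>T\<close> and the tail sum \<open>S\<close>.\<close>

definition slack :: "nat \<Rightarrow> real ^ 'k :: {finite,linorder} \<Rightarrow> 'k \<Rightarrow> real" where
  "slack d c i = (real d - real (coord_pos i)) * total_weight c - real d * tail_sum c i"

definition tail_polytope :: "nat \<Rightarrow> (real ^ 'k :: {finite,linorder}) set" where
  "tail_polytope d = {c. (\<forall>i. 0 \<le> c $ i) \<and>
     (\<forall>i. 0 \<le> slack d c i)}"

lemma total_weight_pos: "(\<And>i. 0 \<le> c $ i) \<Longrightarrow> 0 < total_weight c"
  by (auto simp: total_weight_def intro!: add_pos_nonneg sum_nonneg)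

lemma total_weight_minus_tail_sum:
  "total_weight c - tail_sum c i = 1 + (\<Sum>j\<in>{..<i}. c $ j)"
proof -
  have "(\<Sum>j\<in>UNIV. c $ j) = (\<Sum>j\<in>{..<i}. c $ j) + (\<Sum>j\<in>{i..}. c $ j)"
    by (subst sum.union_disjoint[symmetric]) (auto intro!: sum.cong)
  thus ?thesis by (simp add: total_weight_def tail_sum_def)
qed

text \<open>Abel summation for a decreasing \<open>x\<close> and nonnegative partial sums of \<open>e\<close>, arranged for
  induction on \<open>n\<close>.\<close>

lemma sum_mult_antimono_ge:
  fixes e x :: "nat \<Rightarrow> real"
  assumes "\<And>p. p \<le> n \<Longrightarrow> 0 \<le> (\<Sum>q<p. e q)" "\<And>p. p < n \<Longrightarrow> x (Suc p) \<le> x p"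
  shows "(\<Sum>q\<le>n. e q) * x n \<le> (\<Sum>q\<le>n. e q * x q)"
  using assms
proof (induction n)
  case (Suc n)
  have "0 \<le> (\<Sum>q\<le>n. e q)" using Suc.prems(1)[of "Suc n"] by (simp add: lessThan_Suc_atMost)
  hence "(\<Sum>q\<le>n. e q) * x (Suc n) \<le> (\<Sum>q\<le>n. e q) * x n"
    using Suc.prems(2)[of n] by (intro mult_left_mono) auto
  also have "\<dots> \<le> (\<Sum>q\<le>n. e q * x q)" using Suc by simp
  finally show ?case by (simp add: algebra_simps)
qed simp

lemma weighted_product_ge_1_iff:
  fixes c :: "real ^ 'k :: {finite,linorder}"
  assumes "a 0 \<noteq> 0" "\<And>i :: 'k. a (coord_pos i) \<noteq> 0"
  shows "norm (a 0) * (\<Prod>i\<in>UNIV. norm (a (coord_pos i)) powr (c $ i)) \<ge> 1 \<longleftrightarrow>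
    0 \<le> ln (norm (a 0)) + (\<Sum>i\<in>UNIV. c $ i * ln (norm (a (coord_pos i))))"
proof -
  have "norm (a 0) * (\<Prod>i\<in>UNIV. norm (a (coord_pos i)) powr (c $ i)) =
      exp (ln (norm (a 0)) + (\<Sum>i\<in>UNIV. c $ i * ln (norm (a (coord_pos i)))))"
    using assms by (simp add: exp_add exp_sum powr_def)
  thus ?thesis by simp
qed

text \<open>The weights \<open>b\<close> put 1 at position 0 and \<open>c\<close> at the positions from 1 to \<open>CARD('k)\<close>.  Subtracting their mean
  \<open>T / d\<close> costs a nonnegative multiple of the sum of \<open>x\<close> and leaves weights of total 0, whose
  partial sums are nonnegative because \<open>c\<close> and the slacks are; Abel summation concludes.\<close>

lemma tail_polytope_weighted_sum_nonneg:
  fixes c :: "real ^ 'k :: {finite,linorder}"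
  assumes c: "c \<in> tail_polytope d" and d: "CARD('k) < d"
    and x: "\<And>i j. i \<le> j \<Longrightarrow> j < d \<Longrightarrow> x j \<le> x i" "0 \<le> (\<Sum>i<d. x i)"
  shows "0 \<le> x 0 + (\<Sum>i\<in>UNIV. c $ i * x (coord_pos i))"
proof -
  define T where "T = total_weight c"
  have c0: "0 \<le> c $ i" for i using c by (simp add: tail_polytope_def)
  have T: "T > 0" unfolding T_def using c0 by (rule total_weight_pos)
  define b where "b = (\<lambda>p. (\<Sum>i | coord_pos i = p. c $ i) + (if p = 0 then 1 else 0))"
  define e where "e = (\<lambda>p. b p - T / d)"
  have b_sum: "(\<Sum>q<p. b q * f q) = f 0 + (\<Sum>i | coord_pos i < p. c $ i * f (coord_pos i))"
    if "p > 0" for f p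
  proof -
    have "(\<Sum>q<p. b q * f q) = (\<Sum>q<p. (\<Sum>i | coord_pos i = q. c $ i * f (coord_pos i)) + (if q = 0 then f 0 else 0))"
      by (intro sum.cong) (auto simp: b_def distrib_right sum_distrib_right)
    also have "\<dots> = (\<Sum>q<p. \<Sum>i | coord_pos i = q. c $ i * f (coord_pos i)) + f 0"
      using that by (simp add: sum.distrib)
    also have "(\<Sum>q<p. \<Sum>i | coord_pos i = q. c $ i * f (coord_pos i)) =
        (\<Sum>q<p. \<Sum>i\<in>{i\<in>{i. coord_pos i < p}. coord_pos i = q}. c $ i * f (coord_pos i))"
      by (intro sum.cong) auto
    also have "\<dots> = (\<Sum>i | coord_pos i < p. c $ i * f (coord_pos i))"
      by (intro sum.group) auto
    finally show ?thesis by simp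
  qed
  have all: "{i. coord_pos i < p} = (UNIV :: 'k set)" if "p > CARD('k)" for p
    using coord_pos_le_card that by (auto intro: le_less_trans)
  have prefix: "p * T / d \<le> (\<Sum>q<p. b q)" if "p \<le> d" for p
  proof -
    consider "p = 0" | i :: 'k where "p = coord_pos i" | "p > CARD('k)"
      using range_coord_pos[where ?'k = 'k] by (metis One_nat_def Suc_leI atLeastAtMost_iff bot_nat_0.not_eq_extremum imageE not_le)
    thus ?thesis
    proof cases
      case 2
      have "(\<Sum>q<p. b q) = T - tail_sum c i"
        using b_sum[of p "\<lambda>_. 1"] coord_pos_pos[of i]
        by (simp add: 2 T_def total_weight_minus_tail_sum lessThan_def)
      hence "real d * (\<Sum>q<p. b q) = real d * T - real d * tail_sum c i"
        by (simp only: right_diff_distrib)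
      moreover have "real d * tail_sum c i \<le> (real d - real p) * T"
        using c by (simp add: tail_polytope_def slack_def 2 T_def)
      ultimately have "p * T \<le> real d * (\<Sum>q<p. b q)" by (simp add: algebra_simps)
      thus ?thesis using d by (simp add: field_simps)
    next
      case 3
      have "(\<Sum>q<p. b q) = T" using b_sum[of p "\<lambda>_. 1"] 3 all[OF 3]
        by (simp add: T_def total_weight_def)
      moreover have "p * T \<le> d * T" using that T by simp
      ultimately show ?thesis using d by (simp add: field_simps)
    qed auto
  qed
  have e_sum: "(\<Sum>q<p. e q) = (\<Sum>q<p. b q) - p * T / d" for p
    by (simp add: e_def sum_subtractf)
  obtain n where n: "d = Suc n" using d by (cases d) auto
  have "(\<Sum>q<d. b q) = T"
    using b_sum[of d "\<lambda>_. 1"] all[OF d] d by (simp add: T_def total_weight_def)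
  hence "(\<Sum>q<d. e q) = 0" using d by (simp add: e_sum)
  moreover have "(\<Sum>q\<le>n. e q) * x n \<le> (\<Sum>q\<le>n. e q * x q)"
    by (rule sum_mult_antimono_ge) (use prefix n x(1) in \<open>auto simp: e_sum\<close>)
  ultimately have "0 \<le> (\<Sum>q<d. e q * x q)" by (simp add: n lessThan_Suc_atMost)
  also have "\<dots> = (\<Sum>q<d. b q * x q) - T / d * (\<Sum>q<d. x q)"
    by (simp add: e_def left_diff_distrib sum_subtractf sum_distrib_left)
  also have "\<dots> \<le> (\<Sum>q<d. b q * x q)" using T x(2) by simp
  also have "\<dots> = x 0 + (\<Sum>i\<in>UNIV. c $ i * x (coord_pos i))"
    using b_sum[of d x] all[OF d] d by simp
  finally show ?thesis .
qed

lemma tail_polytope_subset_E_set: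
  assumes d: "CARD('k :: {finite,linorder}) < d"
  shows "tail_polytope d \<subseteq> (E_set d :: (real ^ 'k :: {finite,linorder}) set)"
proof
  fix c :: "real ^ 'k :: {finite,linorder}" assume c: "c \<in> tail_polytope d"
  have "norm (a 0) * (\<Prod>i\<in>UNIV. norm (a (coord_pos i)) powr (c $ i)) \<ge> 1"
    if \<alpha>: "algebraic_int \<alpha>" "alg_degree \<alpha> = d" "conj_labelling \<alpha> a" for \<alpha> a
  proof -
    have "CARD('k) > 0" by simp
    hence "d \<ge> 2" using d by linarith
    hence prod: "(\<Prod>i<d. norm (a i)) \<ge> 1"
      using one_le_prod_norm_conjugates[of \<alpha> a] \<alpha> by simp
    have nz: "a i \<noteq> 0" if "i < d" for i
      using prod that by (metis finite_lessThan lessThan_iff norm_zero not_one_le_zero prod_zero)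
    have mono: "norm (a j) \<le> norm (a i)" if "i \<le> j" "j < d" for i j
      using \<alpha>(2,3) that by (auto simp: conj_labelling_def)
    have nzk: "a (coord_pos i) \<noteq> 0" for i :: 'k
      using nz coord_pos_le_card[of i] d by simp
    have "0 \<le> ln (norm (a 0)) + (\<Sum>i\<in>UNIV. c $ i * ln (norm (a (coord_pos i))))"
    proof (rule tail_polytope_weighted_sum_nonneg[OF c d, where x = "\<lambda>i. ln (norm (a i))"])
      show "ln (norm (a j)) \<le> ln (norm (a i))" if "i \<le> j" "j < d" for i j
        using mono[OF that] nz[of i] nz[of j] that by simp
      have "(\<Sum>i<d. ln (norm (a i))) = ln (\<Prod>i<d. norm (a i))"
        using nz by (intro ln_prod[symmetric]) auto
      thus "0 \<le> (\<Sum>i<d. ln (norm (a i)))" using prod by simp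
    qed
    thus ?thesis using weighted_product_ge_1_iff[of a c] nzk nz[of 0] d by simp
  qed
  thus "c \<in> E_set d" using c by (auto simp: E_set_def tail_polytope_def)
qed

text \<open>If the inequality for \<open>m = coord_pos i\<close> failed, the linear form would be negative on the
  corresponding ray.  The logarithms of the moduli of the roots of \<open>z\<^sup>d + N z\<^bsup>d-m\<^esup> + 2\<close> are bounded
  above, up to a bounded error, by the multiple of that ray with factor \<open>ln N / (m (d - m))\<close>; the
  form has nonnegative coefficients, so for large \<open>N\<close> it would be negative there too.\<close>

lemma E_set_subset_tail_polytope:
  assumes d: "CARD('k :: {finite,linorder}) < d"
  shows "(E_set d :: (real ^ 'k :: {finite,linorder}) set) \<subseteq> tail_polytope d"
proof
  fix c :: "real ^ 'k :: {finite,linorder}" assume c: "c \<in> E_set d"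
  have c0: "0 \<le> c $ i" for i using c by (simp add: E_set_def)
  have "0 \<le> slack d c i" for i
  proof (rule ccontr)
    assume viol: "\<not> ?thesis"
    define m where "m = coord_pos i"
    have m: "0 < m" "m < d" using coord_pos_pos[of i] coord_pos_le_card[of i] d by (auto simp: m_def)
    define B where "B = tail_sum c i"
    define A where "A = 1 + (\<Sum>j\<in>{..<i}. c $ j)"
    have AB: "total_weight c = A + B"
      using total_weight_minus_tail_sum[of c i] by (simp add: A_def B_def)
    have AB0: "A \<ge> 0" "B \<ge> 0" using c0 by (auto simp: A_def B_def tail_sum_def intro!: add_nonneg_nonneg sum_nonneg)
    \<comment> \<open>The linear form is at most \<open>- \<delta> ln N\<close> plus a constant.\<close>
    define \<delta> where "\<delta> = B / real (d - m) - A / m"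
    have "(real d - m) * A < m * B"
      using viol by (simp add: slack_def AB m_def B_def algebra_simps)
    hence \<delta>: "\<delta> > 0" using m by (simp add: \<delta>_def field_simps of_nat_diff)
    \<comment> \<open>The last summand of \<open>K\<close> is that constant divided by \<open>\<delta>\<close>; the rest ensures \<open>ln N > 3 * m\<close>.\<close>
    define K where "K = 3 * m + 1 + (A / m + 2 * B / real (d - m)) / \<delta>"
    define N where "N = 2 * \<lceil>exp K\<rceil> + 4"
    have "\<lceil>exp K\<rceil> > 0" by simp
    hence "real_of_int N > exp K" "N \<ge> 4" "even N"
      unfolding N_def by (linarith | simp)+
    hence lnN: "ln N > K" by (metis exp_gt_zero ln_exp ln_less_cancel_iff order.strict_trans)
    have "(A / m + 2 * B / real (d - m)) / \<delta> \<ge> 0" using AB0 \<delta> by simp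
    hence "ln N > 3 * m" using lnN by (simp add: K_def)
    then obtain \<alpha> a where a: "algebraic_int \<alpha>" "alg_degree \<alpha> = d" "conj_labelling \<alpha> a"
      "\<And>i. i < d \<Longrightarrow> a i \<noteq> 0"
      "\<And>i. i < m \<Longrightarrow> ln (norm (a i)) \<le> (ln N + 1) / m"
      "\<And>i. m \<le> i \<Longrightarrow> i < d \<Longrightarrow> ln (norm (a i)) \<le> (2 - ln N) / real (d - m)"
      using trinomial_conjugates[OF m \<open>even N\<close> \<open>N \<ge> 4\<close>] by metis
    have posd: "coord_pos j < d" for j :: 'k using coord_pos_le_card[of j] d by simp
    have "norm (a 0) * (\<Prod>i\<in>UNIV. norm (a (coord_pos i)) powr (c $ i)) \<ge> 1"
      using c a(1-3) by (auto simp: E_set_def)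
    hence "0 \<le> ln (norm (a 0)) + (\<Sum>j\<in>UNIV. c $ j * ln (norm (a (coord_pos j))))"
      using weighted_product_ge_1_iff[of a c] a(4) posd d by simp
    also have "(\<Sum>j\<in>UNIV. c $ j * ln (norm (a (coord_pos j)))) =
        (\<Sum>j\<in>{..<i}. c $ j * ln (norm (a (coord_pos j)))) + (\<Sum>j\<in>{i..}. c $ j * ln (norm (a (coord_pos j))))"
      by (subst sum.union_disjoint[symmetric]) (auto intro!: sum.cong)
    also have "ln (norm (a 0)) + \<dots> \<le> (ln N + 1) / m +
        ((\<Sum>j\<in>{..<i}. c $ j * ((ln N + 1) / m)) + (\<Sum>j\<in>{i..}. c $ j * ((2 - ln N) / real (d - m))))"
      using m posd by (intro add_mono sum_mono mult_left_mono a(5,6) c0) (auto simp: m_def)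
    also have "\<dots> = A * ((ln N + 1) / m) + B * ((2 - ln N) / real (d - m))"
      by (simp only: A_def B_def tail_sum_def sum_distrib_right distrib_right mult_1_left add.assoc)
    also have "\<dots> = A / m + 2 * B / real (d - m) - ln N * \<delta>"
      by (simp add: \<delta>_def add_divide_distrib diff_divide_distrib algebra_simps)
    finally have "ln N \<le> (A / m + 2 * B / real (d - m)) / \<delta>" using \<delta> by (simp add: field_simps)
    thus False using lnN by (simp add: K_def)
  qed
  thus "c \<in> tail_polytope d" using c0 by (simp add: tail_polytope_def)
qed

section \<open>Extreme points of the polytope\<close>

text \<open>Boundedness comes from the inequality at the first coordinate, where the tail sum is the sum
  \<open>S\<close> of all entries: \<open>d S \<le> (d - 1) (1 + S)\<close>, that is, \<open>S \<le> d - 1\<close>.\<close>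

lemma polytope_tail_polytope:
  assumes d: "CARD('k :: {finite,linorder}) < d"
  shows "polytope (tail_polytope d :: (real ^ 'k :: {finite,linorder}) set)"
proof -
  define a :: "'k :: {finite,linorder} \<Rightarrow> real ^ 'k :: {finite,linorder}" where
    "a = (\<lambda>i. \<chi> j. (if i \<le> j then real d else 0) - (real d - real (coord_pos i)))"
  have a: "a i \<bullet> c \<le> real d - real (coord_pos i) \<longleftrightarrow> 0 \<le> slack d c i" for i c
  proof -
    have "a i \<bullet> c = (\<Sum>j\<in>UNIV. (if i \<le> j then real d * c $ j else 0)) - (\<Sum>j\<in>UNIV. (real d - real (coord_pos i)) * c $ j)"
      unfolding sum_subtractf[symmetric] by (simp add: inner_vec_def a_def) (intro sum.cong, auto simp: algebra_simps)
    also have "(\<Sum>j\<in>UNIV. (if i \<le> j then real d * c $ j else 0)) = real d * tail_sum c i"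
      by (subst sum.inter_filter[symmetric]) (auto simp: tail_sum_def sum_distrib_left atLeast_def)
    also have "(\<Sum>j\<in>UNIV. (real d - real (coord_pos i)) * c $ j) =
        (real d - real (coord_pos i)) * (\<Sum>j\<in>UNIV. c $ j)"
      by (simp only: sum_distrib_left)
    also have "real d * tail_sum c i - \<dots> = real d - real (coord_pos i) - slack d c i"
      by (simp add: slack_def total_weight_def distrib_left)
    finally show ?thesis by simp
  qed
  have "tail_polytope d = (\<Inter>i. {c :: real ^ 'k :: {finite,linorder}. axis i 1 \<bullet> c \<ge> 0}) \<inter>
      (\<Inter>i. {c. a i \<bullet> c \<le> real d - real (coord_pos i)})"
    by (auto simp: tail_polytope_def a inner_axis')
  moreover have "polyhedron \<dots>"
    by (intro polyhedron_Int polyhedron_Inter)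
       (auto simp: polyhedron_halfspace_le polyhedron_halfspace_ge)
  ultimately have "polyhedron (tail_polytope d :: (real ^ 'k :: {finite,linorder}) set)" by simp
  moreover have "norm c \<le> real d" if c: "c \<in> tail_polytope d" for c :: "real ^ 'k :: {finite,linorder}"
  proof -
    define S where "S = (\<Sum>j\<in>UNIV. c $ j)"
    have c0: "0 \<le> c $ j" for j using c by (simp add: tail_polytope_def)
    define i :: "'k :: {finite,linorder}" where "i = Min UNIV"
    have "{i..} = UNIV" by (auto simp: i_def)
    hence "real d * S \<le> (real d - real (coord_pos i)) * (1 + S)"
      using c by (auto simp: tail_polytope_def slack_def tail_sum_def total_weight_def S_def dest: spec[of _ i])
    also have "\<dots> \<le> (real d - 1) * (1 + S)"
      using coord_pos_pos[of i] c0 by (intro mult_right_mono) (auto simp: S_def intro!: add_nonneg_nonneg sum_nonneg)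
    finally have "S \<le> real d" by (simp add: algebra_simps)
    moreover have "norm c \<le> (\<Sum>j\<in>UNIV. \<bar>c $ j\<bar>)" by (rule norm_le_l1_cart)
    ultimately show ?thesis using c0 by (simp add: S_def)
  qed
  hence "bounded (tail_polytope d :: (real ^ 'k :: {finite,linorder}) set)" by (auto simp: bounded_iff)
  ultimately show ?thesis by (simp add: polytope_eq_bounded_polyhedron)
qed

text \<open>When \<open>c\<^sub>i = 0\<close>, the tail sums at \<open>i\<close> and at the next coordinate agree, but the bound at the
  next coordinate is strictly smaller.\<close>

lemma slack_pos_if_coord_zero:
  fixes c :: "real ^ 'k :: {finite,linorder}"
  assumes d: "CARD('k) < d" and c: "c \<in> tail_polytope d" and i: "c $ i = 0"
  shows "0 < slack d c i"
proof -
  have W: "0 < total_weight c" using c by (intro total_weight_pos) (simp add: tail_polytope_def)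
  have split: "{i..} = insert i {i<..}" by auto
  have tail: "tail_sum c i = (\<Sum>j\<in>{i<..}. c $ j)"
    unfolding tail_sum_def split using i by simp
  show ?thesis
  proof (cases "{i<..} = {}")
    case True
    with W d coord_pos_le_card[of i] show ?thesis by (simp add: slack_def tail)
  next
    case False
    define j where "j = Min {i<..}"
    have "j \<in> {i<..}" unfolding j_def using False by (intro Min_in) auto
    hence "i < j" by simp
    have "{i<..} = {j..}"
      using \<open>i < j\<close> by (auto simp: j_def)
    hence "tail_sum c i = tail_sum c j" unfolding tail by (simp add: tail_sum_def)
    hence "slack d c i = slack d c j + (real (coord_pos j) - real (coord_pos i)) * total_weight c"
      by (simp add: slack_def algebra_simps)
    moreover have "0 \<le> slack d c j" using c by (simp add: tail_polytope_def)
    moreover have "0 < (real (coord_pos j) - real (coord_pos i)) * total_weight c"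
      using W \<open>i < j\<close> by simp
    ultimately show ?thesis by linarith
  qed
qed

lemma tail_sum_add: "tail_sum (x + y) i = tail_sum x i + tail_sum y i"
  and tail_sum_scaleR: "tail_sum (t *\<^sub>R x) i = t * tail_sum x i"
  by (simp_all add: tail_sum_def sum.distrib sum_distrib_left)

text \<open>The slack is affine along lines; the factor of \<open>t\<close> is its homogeneous part at \<open>w\<close>.\<close>

lemma slack_add_scaleR:
  "slack d (c + t *\<^sub>R w) i = slack d c i +
     t * ((real d - real (coord_pos i)) * (\<Sum>j\<in>UNIV. w $ j) - real d * tail_sum w i)"
proof -
  have "total_weight (c + t *\<^sub>R w) = total_weight c + t * (\<Sum>j\<in>UNIV. w $ j)"
    by (simp add: total_weight_def sum.distrib sum_distrib_left)
  thus ?thesis by (simp add: slack_def tail_sum_add tail_sum_scaleR algebra_simps)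
qed

text \<open>Let \<open>w = y - x\<close>.  At the first coordinate in the support of \<open>w\<close> the tail sum of \<open>w\<close> is its
  whole sum, and the homogeneous equation forces that sum to be 0.  At the last coordinate in the
  support the tail sum is a single entry of \<open>w\<close>, which is then 0 as well: a contradiction.\<close>

lemma eq_if_slack_zero_on_support:
  fixes x y :: "real ^ 'k :: {finite,linorder}"
  assumes d: "0 < d"
    and zero: "\<And>i. i \<notin> J \<Longrightarrow> x $ i = 0 \<and> y $ i = 0"
    and tight: "\<And>i. i \<in> J \<Longrightarrow> slack d x i = 0 \<and> slack d y i = 0"
  shows "x = y"
proof (rule ccontr)
  assume "x \<noteq> y"
  define w where "w = y - x"
  define A where "A = {i. w $ i \<noteq> 0}"
  obtain i where "x $ i \<noteq> y $ i" using \<open>x \<noteq> y\<close> by (auto simp: vec_eq_iff)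
  hence "i \<in> A" by (simp add: A_def w_def)
  hence "A \<noteq> {}" by auto
  have AJ: "A \<subseteq> J"
  proof
    fix i assume "i \<in> A"
    thus "i \<in> J" using zero[of i] by (cases "i \<in> J") (auto simp: A_def w_def)
  qed
  have y: "y = x + 1 *\<^sub>R w" by (simp add: w_def)
  have eq: "real d * tail_sum w i = (real d - real (coord_pos i)) * (\<Sum>j\<in>UNIV. w $ j)"
    if "i \<in> A" for i
    using slack_add_scaleR[of d x 1 w i] tight[of i] that AJ unfolding y[symmetric] by auto
  define m where "m = Min A"
  have m: "m \<in> A" unfolding m_def using \<open>A \<noteq> {}\<close> by (intro Min_in) auto
  have "tail_sum w m = (\<Sum>j\<in>UNIV. w $ j)"
    unfolding tail_sum_def
  proof (rule sum.mono_neutral_left)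
    show "\<forall>i\<in>UNIV - {m..}. w $ i = 0"
      by (auto simp: m_def A_def)
  qed auto
  with eq[OF m] have "(\<Sum>j\<in>UNIV. w $ j) = 0"
    using coord_pos_pos[of m] by (simp add: algebra_simps)
  define M where "M = Max A"
  have M: "M \<in> A" unfolding M_def using \<open>A \<noteq> {}\<close> by (intro Max_in) auto
  have "tail_sum w M = (\<Sum>j\<in>{M}. w $ j)"
    unfolding tail_sum_def
  proof (rule sum.mono_neutral_right)
    show "\<forall>i\<in>{M..} - {M}. w $ i = 0"
    proof
      fix i assume "i \<in> {M..} - {M}"
      hence "\<not> i \<le> M" by auto
      hence "i \<notin> A" unfolding M_def by auto
      thus "w $ i = 0" by (simp add: A_def)
    qed
  qed auto
  with eq[OF M] \<open>_ = 0\<close> d have "w $ M = 0" by simp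
  with M show False by (simp add: A_def)
qed

text \<open>Constraints that are not active at \<open>c\<close> survive a small move in either direction, and the
  active ones are constant along \<open>w\<close>.\<close>

lemma not_extreme_point_if_feasible_direction:
  fixes c w :: "real ^ 'k :: {finite,linorder}"
  assumes c: "c \<in> tail_polytope d" and "w \<noteq> 0"
    and coord: "\<And>i. c $ i = 0 \<Longrightarrow> w $ i = 0"
    and slack: "\<And>i. slack d c i = 0 \<Longrightarrow>
      real d * tail_sum w i = (real d - real (coord_pos i)) * (\<Sum>j\<in>UNIV. w $ j)"
  shows "\<not> c extreme_point_of tail_polytope d"
proof
  assume ext: "c extreme_point_of tail_polytope d"
  have lin: "\<forall>\<^sub>F t in nhds 0. 0 \<le> \<alpha> + t * \<beta>" if "0 \<le> \<alpha>" "\<alpha> = 0 \<Longrightarrow> \<beta> = 0" for \<alpha> \<beta> :: real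
  proof (cases "\<alpha> = 0")
    case False
    have "((\<lambda>t. \<alpha> + t * \<beta>) \<longlongrightarrow> \<alpha> + 0 * \<beta>) (nhds 0)" 
      by (intro tendsto_intros filterlim_ident)
    hence "\<forall>\<^sub>F t in nhds 0. 0 < \<alpha> + t * \<beta>"
      by (rule order_tendstoD) (use False that in auto)
    thus ?thesis by eventually_elim simp
  qed (use that in auto)
  have "\<forall>\<^sub>F t in nhds 0. \<forall>i. 0 \<le> (c + t *\<^sub>R w) $ i"
    using c by (auto intro!: eventually_all_finite lin coord simp: tail_polytope_def)
  moreover have "\<forall>\<^sub>F t in nhds 0. \<forall>i. 0 \<le> slack d (c + t *\<^sub>R w) i"
    unfolding slack_add_scaleR
    using c by (auto intro!: eventually_all_finite lin slack[symmetric] simp: tail_polytope_def)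
  ultimately have "\<forall>\<^sub>F t in nhds 0. c + t *\<^sub>R w \<in> tail_polytope d"
    by eventually_elim (simp add: tail_polytope_def)
  then obtain \<epsilon> where \<epsilon>: "\<epsilon> > 0" "\<And>t. \<bar>t\<bar> < \<epsilon> \<Longrightarrow> c + t *\<^sub>R w \<in> tail_polytope d"
    by (auto simp: eventually_nhds_metric dist_real_def)
  define x where "x = c + (- \<epsilon> / 2) *\<^sub>R w"
  define y where "y = c + (\<epsilon> / 2) *\<^sub>R w"
  have "x \<in> tail_polytope d" "y \<in> tail_polytope d"
    unfolding x_def y_def using \<epsilon>(1) by (intro \<epsilon>(2); simp)+
  moreover have "x \<noteq> y" using \<epsilon>(1) \<open>w \<noteq> 0\<close> by (auto simp: x_def y_def vec_eq_iff)
  moreover have "c = midpoint x y" by (simp add: midpoint_def x_def y_def vec_eq_iff)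
  moreover from calculation have "c \<in> open_segment x y" by simp
  ultimately show False using ext unfolding extreme_point_of_def by blast
qed

text \<open>Suppose neither constraint at \<open>i\<close> is active.  If \<open>j\<close> is the last coordinate before \<open>i\<close>
  with \<open>c\<^sub>j \<noteq> 0\<close>, weight can be moved from \<open>j\<close> to \<open>i\<close> and back: this keeps the total weight and
  changes only the tail sums strictly after \<open>j\<close> and up to \<open>i\<close>, whose bounds are not active since
  the entries strictly between \<open>j\<close> and \<open>i\<close> vanish.  If there is no such \<open>j\<close>, the entries after \<open>i\<close> and the
  total weight are scaled by a common factor, which preserves the active bounds after \<open>i\<close>, and
  the entry at \<open>i\<close> absorbs the difference.\<close>

lemma extreme_point_imp_tight:
  fixes c :: "real ^ 'k :: {finite,linorder}"
  assumes d: "CARD('k) < d" and ext: "c extreme_point_of tail_polytope d" and i: "c $ i \<noteq> 0"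
  shows "slack d c i = 0"
proof (rule ccontr)
  assume si: "slack d c i \<noteq> 0"
  have c: "c \<in> tail_polytope d" using ext by (simp add: extreme_point_of_def)
  have c0: "0 \<le> c $ j" for j using c by (simp add: tail_polytope_def)
  have zs: "slack d c j \<noteq> 0" if "c $ j = 0" for j
    using slack_pos_if_coord_zero[OF d c that] by simp
  define A where "A = {j. j < i \<and> c $ j \<noteq> 0}"
  show False
  proof (cases "A = {}")
    case False
    define j where "j = Max A"
    have "j \<in> A" unfolding j_def using False by (intro Max_in) auto
    hence j: "j < i" "c $ j \<noteq> 0" by (auto simp: A_def)
    have nz: "slack d c l \<noteq> 0" if "j < l" "l \<le> i" for l
    proof (cases "l = i")
      case False
      have "l \<notin> A"
      proof
        assume "l \<in> A"
        hence "l \<le> j" unfolding j_def by (intro Max_ge) auto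
        with that show False by simp
      qed
      thus ?thesis using that False zs by (auto simp: A_def)
    qed (use si in simp)
    define w :: "real ^ 'k :: {finite,linorder}" where "w = axis i 1 - axis j 1"
    have tail: "tail_sum w l = (if l \<le> i then 1 else 0) - (if l \<le> j then 1 else 0)" for l
      by (simp add: tail_sum_def w_def axis_def sum_subtractf)
    have "(\<Sum>l\<in>UNIV. w $ l) = 0" by (simp add: w_def axis_def sum_subtractf)
    moreover have "w $ i = 1" using j by (simp add: w_def axis_def)
    hence "w \<noteq> 0" by auto
    moreover have "w $ l = 0" if "c $ l = 0" for l using that i j by (auto simp: w_def axis_def)
    moreover have "tail_sum w l = 0" if "slack d c l = 0" for l
    proof -
      have "l \<le> j \<or> \<not> l \<le> i" using nz[of l] that by (meson not_le)
      thus ?thesis using j by (auto simp: tail)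
    qed
    ultimately show False using not_extreme_point_if_feasible_direction[OF c, of w] ext by simp
  next
    case True
    \<comment> \<open>The entry of \<open>w\<close> at \<open>i\<close> is chosen such that \<open>w\<close> sums up to the total weight of \<open>c\<close>.\<close>
    define r where "r = (\<Sum>l\<in>{i<..}. c $ l)"
    define w :: "real ^ 'k :: {finite,linorder}" where
      "w = (\<chi> l. if l < i then 0 else if l = i then total_weight c - r else c $ l)"
    have "(\<Sum>l\<in>UNIV. w $ l) = (\<Sum>l\<in>insert i {i<..}. w $ l)"
      by (rule sum.mono_neutral_right) (auto simp: w_def)
    also have "\<dots> = total_weight c - r + (\<Sum>l\<in>{i<..}. w $ l)" by (simp add: w_def)
    also have "(\<Sum>l\<in>{i<..}. w $ l) = r" unfolding r_def by (intro sum.cong) (auto simp: w_def)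
    finally have sum: "(\<Sum>l\<in>UNIV. w $ l) = total_weight c" by simp
    have tail: "tail_sum w l = tail_sum c l" if "i < l" for l
      unfolding tail_sum_def using that by (intro sum.cong) (auto simp: w_def)
    have "total_weight c > 0" using c0 by (rule total_weight_pos)
    hence "w \<noteq> 0" using sum by auto
    moreover have "w $ l = 0" if "c $ l = 0" for l using that i by (auto simp: w_def)
    moreover have "real d * tail_sum w l = (real d - real (coord_pos l)) * (\<Sum>j\<in>UNIV. w $ j)"
      if "slack d c l = 0" for l
    proof -
      have "c $ l \<noteq> 0" using zs that by blast
      hence "\<not> l < i" using True by (auto simp: A_def)
      moreover have "l \<noteq> i" using si that by blast
      ultimately have "i < l" by simp
      from tail[OF this] that show ?thesis by (simp add: sum slack_def)
    qed
    ultimately show False using not_extreme_point_if_feasible_direction[OF c, of w] ext by simp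
  qed
qed

lemma extreme_point_if_tight:
  fixes c :: "real ^ 'k :: {finite,linorder}"
  assumes d: "0 < d" and c: "c \<in> tail_polytope d"
    and tight: "\<And>i. c $ i \<noteq> 0 \<Longrightarrow> slack d c i = 0"
  shows "c extreme_point_of tail_polytope d"
  unfolding extreme_point_of_def
proof (intro conjI ballI notI)
  fix x y assume xy: "x \<in> tail_polytope d" "y \<in> tail_polytope d" and "c \<in> open_segment x y"
  then obtain u where u: "x \<noteq> y" "0 < u" "u < 1" "c = (1 - u) *\<^sub>R x + u *\<^sub>R y"
    by (auto simp: in_segment)
  have zero: "\<alpha> = 0 \<and> \<beta> = 0" if "0 \<le> \<alpha>" "0 \<le> \<beta>" "(1 - u) * \<alpha> + u * \<beta> = 0" for \<alpha> \<beta>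
    using that u(2,3) by (simp add: add_nonneg_eq_0_iff)
  have cx: "c = x + u *\<^sub>R (y - x)" "y = x + 1 *\<^sub>R (y - x)" using u(4) by (simp_all add: algebra_simps)
  have slack: "slack d c i = (1 - u) * slack d x i + u * slack d y i" for i
  proof -
    let ?h = "(real d - real (coord_pos i)) * (\<Sum>j\<in>UNIV. (y - x) $ j) - real d * tail_sum (y - x) i"
    have "slack d y i = slack d x i + 1 * ?h"
      by (subst cx(2), rule slack_add_scaleR)
    hence "?h = slack d y i - slack d x i" by simp
    moreover have "slack d c i = slack d x i + u * ?h"
      unfolding cx(1) by (rule slack_add_scaleR)
    ultimately show ?thesis by (simp only:) (simp add: algebra_simps)
  qed
  have "x = y"
  proof (rule eq_if_slack_zero_on_support[OF d, where J = "{i. c $ i \<noteq> 0}"])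
    fix i assume "i \<notin> {i. c $ i \<noteq> 0}"
    thus "x $ i = 0 \<and> y $ i = 0" using xy u(4) by (intro zero) (auto simp: tail_polytope_def)
  next
    fix i assume "i \<in> {i. c $ i \<noteq> 0}"
    thus "slack d x i = 0 \<and> slack d y i = 0"
      using xy tight[of i] slack[of i] by (intro zero) (auto simp: tail_polytope_def)
  qed
  with u(1) show False by simp
qed (rule c)

lemma extreme_point_tail_polytope_iff:
  fixes c :: "real ^ 'k :: {finite,linorder}"
  assumes d: "CARD('k) < d"
  shows "c extreme_point_of tail_polytope d \<longleftrightarrow>
    c \<in> tail_polytope d \<and> (\<forall>i. c $ i \<noteq> 0 \<longrightarrow> slack d c i = 0)"
proof
  assume "c extreme_point_of tail_polytope d"
  thus "c \<in> tail_polytope d \<and> (\<forall>i. c $ i \<noteq> 0 \<longrightarrow> slack d c i = 0)"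
    using extreme_point_imp_tight[OF d] by (auto simp: extreme_point_of_def)
next
  assume "c \<in> tail_polytope d \<and> (\<forall>i. c $ i \<noteq> 0 \<longrightarrow> slack d c i = 0)"
  thus "c extreme_point_of tail_polytope d" using d by (intro extreme_point_if_tight) auto
qed

text \<open>With \<open>j (Suc n) = d\<close> the two nonzero cases of the formula for the vertex become one, and the
  tail sums telescope: the tail sum from any position on is \<open>(d - j l) / j 1\<close>, where \<open>j l\<close> is the first
  element of \<open>j ` {1..n}\<close> that is not smaller than the position, and 0 if there is none.  In
  the first case the total weight is \<open>d / j 1\<close>, so the slack is a positive multiple of the distance from the position to \<open>j l\<close> and
  vanishes exactly at the elements of that set; in the second case the slack is positive.\<close>

lemma vertex_of_subset:
  fixes v :: "real ^ 'k :: {finite,linorder}" and j :: "nat \<Rightarrow> nat"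
  assumes d: "CARD('k) < d"
    and j: "j ` {1..n} \<subseteq> {1..CARD('k)}" "strict_mono_on {1..n} j" "j (Suc n) = d"
    and v0: "\<And>i. coord_pos i \<notin> j ` {1..n} \<Longrightarrow> v $ i = 0"
    and v: "\<And>i l. l \<in> {1..n} \<Longrightarrow> coord_pos i = j l \<Longrightarrow>
      v $ i = (real (j (Suc l)) - real (j l)) / real (j 1)"
  shows "v extreme_point_of tail_polytope d" "{i. v $ i \<noteq> 0} = {i. coord_pos i \<in> j ` {1..n}}"
proof -
  have "j l \<in> {1..CARD('k)}" if "l \<in> {1..n}" for l using that j(1) by blast
  hence j_pos: "0 < j l" and j_le: "j l \<le> CARD('k)" if "l \<in> {1..n}" for l
    using that by fastforce+
  have step: "j l < j (Suc l)" if "l \<in> {1..n}" for l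
  proof (cases "l = n")
    case True
    thus ?thesis using j_le[OF that] d j(3) by simp
  next
    case False
    thus ?thesis using that by (intro strict_mono_onD[OF j(2)]) auto
  qed
  have v_pos: "0 < v $ i" if i: "coord_pos i \<in> j ` {1..n}" for i
  proof -
    obtain l where l: "l \<in> {1..n}" "coord_pos i = j l" using i by auto
    hence "1 \<in> {1..n}" by simp
    thus ?thesis unfolding v[OF l] using step[OF l(1)] j_pos[of 1] by simp
  qed
  show supp: "{i. v $ i \<noteq> 0} = {i. coord_pos i \<in> j ` {1..n}}"
    using v0 v_pos by (metis less_irrefl)
  define g :: "nat \<Rightarrow> 'k" where "g = (\<lambda>l. inv coord_pos (j l))"
  have g: "coord_pos (g l) = j l" if "l \<in> {1..n}" for l
  proof -
    have "j l \<in> range (coord_pos :: 'k \<Rightarrow> nat)" using that j(1) unfolding range_coord_pos by blast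
    thus ?thesis unfolding g_def by (rule f_inv_into_f)
  qed
  have inj: "inj_on j {1..n}" by (rule strict_mono_on_imp_inj_on[OF j(2)])
  have sum_l: "(\<Sum>i | p \<le> coord_pos i. v $ i) =
      (\<Sum>l | l \<in> {1..n} \<and> p \<le> j l. (real (j (Suc l)) - real (j l)) / real (j 1))" for p
  proof -
    have "(\<Sum>i | p \<le> coord_pos i. v $ i) = (\<Sum>i\<in>g ` {l \<in> {1..n}. p \<le> j l}. v $ i)"
    proof (rule sum.mono_neutral_right)
      show "g ` {l \<in> {1..n}. p \<le> j l} \<subseteq> {i. p \<le> coord_pos i}" using g by auto
      show "\<forall>i\<in>{i. p \<le> coord_pos i} - g ` {l \<in> {1..n}. p \<le> j l}. v $ i = 0"
      proof
        fix i assume i: "i \<in> {i. p \<le> coord_pos i} - g ` {l \<in> {1..n}. p \<le> j l}"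
        show "v $ i = 0"
        proof (rule v0, rule notI)
          assume "coord_pos i \<in> j ` {1..n}"
          then obtain l where l: "l \<in> {1..n}" "coord_pos i = j l" by auto
          hence "i = g l" by (simp add: g_def inj_coord_pos flip: l(2))
          with i l show False by auto
        qed
      qed
    qed auto
    also have "\<dots> = (\<Sum>l\<in>{l \<in> {1..n}. p \<le> j l}. v $ g l)"
    proof (rule sum.reindex_cong[OF _ refl refl])
      show "inj_on g {l \<in> {1..n}. p \<le> j l}"
        by (rule inj_onI) (metis (no_types, lifting) g inj inj_onD mem_Collect_eq)
    qed
    also have "\<dots> = (\<Sum>l | l \<in> {1..n} \<and> p \<le> j l. (real (j (Suc l)) - real (j l)) / real (j 1))"
      by (intro sum.cong refl v g) auto
    finally show ?thesis .
  qed
  have telescope: "(\<Sum>i | p \<le> coord_pos i. v $ i) = (real d - real (j l)) / real (j 1)"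
    if "l \<in> {1..n}" "p \<le> j l" "\<And>l'. l' \<in> {1..<l} \<Longrightarrow> j l' < p" for p l
  proof -
    have "{l' \<in> {1..n}. p \<le> j l'} = {l..n}"
    proof (intro equalityI subsetI)
      fix l' assume "l' \<in> {l' \<in> {1..n}. p \<le> j l'}"
      thus "l' \<in> {l..n}" using that(3)[of l'] by (cases "l' < l") auto
    next
      fix l' assume l': "l' \<in> {l..n}"
      have "j l \<le> j l'" using l' that(1) by (intro monotone_onD[OF strict_mono_on_imp_mono_on[OF j(2)]]) auto
      thus "l' \<in> {l' \<in> {1..n}. p \<le> j l'}" using l' that by auto
    qed
    hence "(\<Sum>i | p \<le> coord_pos i. v $ i) = (\<Sum>l'=l..n. real (j (Suc l')) - real (j l')) / real (j 1)"
      unfolding sum_l by (simp add: sum_divide_distrib)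
    also have "(\<Sum>l'=l..n. real (j (Suc l')) - real (j l')) = real d - real (j l)"
      using that(1) by (subst sum_Suc_diff) (auto simp: j(3))
    finally show ?thesis .
  qed
  have tail: "tail_sum v i = (\<Sum>i' | coord_pos i \<le> coord_pos i'. v $ i')" for i
    by (simp add: tail_sum_def atLeast_def)
  have W: "total_weight v = real d / real (j 1)" if "n > 0"
    using telescope[of 1 0] j_pos[of 1] that by (simp add: total_weight_def field_simps)
  have W_pos: "0 < total_weight v"
    using v_pos v0 by (intro total_weight_pos) (metis less_eq_real_def)
  have slack: "0 \<le> slack d v i \<and> (coord_pos i \<in> j ` {1..n} \<longrightarrow> slack d v i = 0)" for i
  proof (cases "\<exists>l\<in>{1..n}. coord_pos i \<le> j l")
    case True
    define l where "l = (LEAST l. l \<in> {1..n} \<and> coord_pos i \<le> j l)"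
    have l: "l \<in> {1..n} \<and> coord_pos i \<le> j l"
      unfolding l_def by (rule LeastI_ex) (use True in auto)
    have less: "j l' < coord_pos i" if "l' \<in> {1..<l}" for l'
      using not_less_Least[of l' "\<lambda>l. l \<in> {1..n} \<and> coord_pos i \<le> j l"] that l
      unfolding l_def[symmetric] by auto
    have j1: "0 < j 1" and n: "n > 0" using l j_pos[of 1] by auto
    have t: "tail_sum v i = (real d - real (j l)) / real (j 1)"
      unfolding tail by (rule telescope) (use l less in auto)
    hence s: "slack d v i = real d * (real (j l) - real (coord_pos i)) / real (j 1)"
      by (simp add: slack_def W[OF n] t algebra_simps diff_divide_distrib)
    have "j l = coord_pos i" if i: "coord_pos i \<in> j ` {1..n}"
    proof -
      obtain l' where l': "l' \<in> {1..n}" "coord_pos i = j l'" using i by auto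
      hence "l \<le> l'" using less[of l'] by (cases "l' < l") auto
      hence "j l \<le> j l'" using l' l by (intro monotone_onD[OF strict_mono_on_imp_mono_on[OF j(2)]]) auto
      with l l' show ?thesis by simp
    qed
    with s l show ?thesis by simp
  next
    case False
    hence "{l. l \<in> {1..n} \<and> coord_pos i \<le> j l} = {}" by auto
    hence "tail_sum v i = 0" unfolding tail sum_l by (simp only: sum.empty)
    moreover have "coord_pos i \<notin> j ` {1..n}" using False by auto
    ultimately show ?thesis using W_pos coord_pos_le_card[of i] d by (simp add: slack_def)
  qed
  have "0 \<le> v $ i" for i using v_pos[of i] v0[of i] by (cases "coord_pos i \<in> j ` {1..n}") auto
  hence "v \<in> tail_polytope d" using slack by (simp add: tail_polytope_def)
  moreover have "slack d v i = 0" if "v $ i \<noteq> 0" for i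
    using that v0[of i] slack[of i] by blast
  ultimately show "v extreme_point_of tail_polytope d"
    unfolding extreme_point_tail_polytope_iff[OF d] by blast
qed

text \<open>An extreme point is determined by its support, and every set of coordinates is the support
  of one.\<close>

lemma card_extreme_points_tail_polytope:
  assumes d: "CARD('k :: {finite,linorder}) < d"
  shows "card {v :: real ^ 'k :: {finite,linorder}. v extreme_point_of tail_polytope d} = 2 ^ CARD('k)"
proof -
  define supp :: "real ^ 'k :: {finite,linorder} \<Rightarrow> 'k set" where "supp = (\<lambda>v. {i. v $ i \<noteq> 0})"
  have "bij_betw supp {v. v extreme_point_of tail_polytope d} (Pow UNIV)"
    unfolding bij_betw_def
  proof
    show "inj_on supp {v. v extreme_point_of tail_polytope d}"
    proof (rule inj_onI)
      fix x y
      assume "x \<in> {v. v extreme_point_of tail_polytope d}" "y \<in> {v. v extreme_point_of tail_polytope d}"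
        and "supp x = supp y"
      thus "x = y" using d
        by (intro eq_if_slack_zero_on_support[where J = "supp x" and d = d])
           (auto simp: supp_def extreme_point_tail_polytope_iff[OF d] set_eq_iff)
    qed
    show "supp ` {v. v extreme_point_of tail_polytope d} = Pow UNIV"
    proof (intro equalityI subsetI)
      fix I :: "'k :: {finite,linorder} set"
      define J where "J = coord_pos ` I"
      define n where "n = card J"
      obtain h where h: "bij_betw h {..<n} J" "strict_mono_on {..<n} h"
        unfolding n_def by (rule ex_bij_betw_strict_mono_card[of J]) (auto simp: J_def)
      define j where "j = (\<lambda>l. if l = Suc n then d else h (l - 1))"
      have "(\<lambda>l. l - 1) ` {1..n} = {..<n}"
        by (auto simp: image_iff intro!: bexI[of _ "Suc _"])
      moreover have "j ` {1..n} = h ` (\<lambda>l. l - 1) ` {1..n}"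
        unfolding image_image by (intro image_cong) (auto simp: j_def)
      ultimately have jJ: "j ` {1..n} = J" using h(1) by (simp add: bij_betw_def)
      have mono: "strict_mono_on {1..n} j"
        by (rule strict_mono_onI) (auto simp: j_def intro!: strict_mono_onD[OF h(2)])
      define v :: "real ^ 'k :: {finite,linorder}" where
        "v = (\<chi> i. if coord_pos i \<in> J
          then (let l = inv_into {1..n} j (coord_pos i) in (real (j (Suc l)) - real (j l)) / real (j 1))
          else 0)"
      have v: "v $ i = (real (j (Suc l)) - real (j l)) / real (j 1)"
        if "l \<in> {1..n}" "coord_pos i = j l" for i l
      proof -
        have "inv_into {1..n} j (coord_pos i) = l"
          using that inv_into_f_f[OF strict_mono_on_imp_inj_on[OF mono]] by simp
        moreover have "coord_pos i \<in> J" using that jJ by auto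
        ultimately show ?thesis by (simp add: v_def)
      qed
      have v0: "v $ i = 0" if "coord_pos i \<notin> j ` {1..n}" for i
        using that unfolding jJ by (simp add: v_def)
      have jn: "j (Suc n) = d" by (simp add: j_def)
      have sub: "j ` {1..n} \<subseteq> {1..CARD('k)}"
        unfolding jJ J_def range_coord_pos[symmetric] by auto
      have "v extreme_point_of tail_polytope d" "{i. v $ i \<noteq> 0} = {i. coord_pos i \<in> j ` {1..n}}"
        using vertex_of_subset[OF d sub mono jn v0 v] by blast+
      moreover have "{i. coord_pos i \<in> j ` {1..n}} = I"
        unfolding jJ J_def by (simp add: inj_image_mem_iff[OF inj_coord_pos])
      ultimately show "I \<in> supp ` {v. v extreme_point_of tail_polytope d}"
        by (auto simp: supp_def)
    qed auto
  qed
  from bij_betw_same_card[OF this] show ?thesis by (simp add: card_Pow)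
qed

theorem theorem1p4:
  fixes k d :: nat
  assumes "k = CARD('k::{finite,linorder})" and "k < d"
  shows "polytope (E_set d :: (real ^ 'k::{finite,linorder}) set)
    \<and> card {v. v extreme_point_of (E_set d :: (real ^ 'k::{finite,linorder}) set)} = 2 ^ k
    \<and> (\<forall>J n (j :: nat \<Rightarrow> nat) (v :: real ^ 'k::{finite,linorder}).
         J \<subseteq> {1..k} \<and> J = j ` {1..n} \<and> strict_mono_on {1..n} j \<and>
         (\<forall>i. coord_pos i \<notin> J \<longrightarrow> v $ i = 0) \<and>
         (\<forall>i l. 1 \<le> l \<and> l < n \<and> coord_pos i = j l \<longrightarrow>
            v $ i = (real (j (l + 1)) - real (j l)) / real (j 1)) \<and>
         (\<forall>i. 1 \<le> n \<and> coord_pos i = j n \<longrightarrow>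
            v $ i = (real d - real (j n)) / real (j 1))
         \<longrightarrow> v extreme_point_of (E_set d))"
proof (intro conjI allI impI)
  have d: "CARD('k) < d" using assms by simp
  have E: "E_set d = (tail_polytope d :: (real ^ 'k::{finite,linorder}) set)"
    using E_set_subset_tail_polytope[OF d] tail_polytope_subset_E_set[OF d] by blast
  show "polytope (E_set d :: (real ^ 'k::{finite,linorder}) set)"
    unfolding E by (rule polytope_tail_polytope[OF d])
  show "card {v. v extreme_point_of (E_set d :: (real ^ 'k::{finite,linorder}) set)} = 2 ^ k"
    unfolding E assms(1) by (rule card_extreme_points_tail_polytope[OF d])
  fix J n and j :: "nat \<Rightarrow> nat" and v :: "real ^ 'k::{finite,linorder}"
  assume *: "J \<subseteq> {1..k} \<and> J = j ` {1..n} \<and> strict_mono_on {1..n} j \<and>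
         (\<forall>i. coord_pos i \<notin> J \<longrightarrow> v $ i = 0) \<and>
         (\<forall>i l. 1 \<le> l \<and> l < n \<and> coord_pos i = j l \<longrightarrow>
            v $ i = (real (j (l + 1)) - real (j l)) / real (j 1)) \<and>
         (\<forall>i. 1 \<le> n \<and> coord_pos i = j n \<longrightarrow>
            v $ i = (real d - real (j n)) / real (j 1))"
  define j' where "j' = j(Suc n := d)"
  have img: "j' ` {1..n} = J" using * by (auto simp: j'_def)
  show "v extreme_point_of (E_set d)"
    unfolding E
  proof (rule vertex_of_subset(1)[OF d, where j = j' and n = n])
    show "j' ` {1..n} \<subseteq> {1..CARD('k)}" unfolding img using * assms(1) by blast
    show "strict_mono_on {1..n} j'"
      using * by (auto simp: j'_def strict_mono_on_def)
    show "v $ i = (real (j' (Suc l)) - real (j' l)) / real (j' 1)"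
      if "l \<in> {1..n}" "coord_pos i = j' l" for i l
      using that * by (cases "l = n") (auto simp: j'_def)
  qed (use * img in \<open>auto simp: j'_def\<close>)
qed

end
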